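(* Let $f$ be the quantum frieze of variables associated with $Q$. Then $f$ induces a quantum frieze pattern on $\Gamma$ (that is, $f(n-i+1,\,j+i+1)=f(i,j)$ for all $(i,j)\in Q_0\times\mathbb{Z}$), and this quantum frieze pattern on $\Gamma$ realises a bijection from $\Gamma_0$ to the set of quantum cluster variables in $\mathcal{A}_\Sigma$.
   Context: Initial data. $n$ is a positive even integer. $Q$ is the quiver with vertex set $Q_0=\{1,\dots,n\}$ and arrows $i\to i+1$ for $1\le i\le n-1$ (linearly oriented Dynkin type $A_n$). $B=(b_{i,j})\in M_n(\mathbb{Z})$ has $b_{i,i+1}=1$, $b_{i,i-1}=-1$ and all other entries $0$. $\Lambda=(B^t)^{-1}=(\Lambda_{i,j})$, i.e. $\Lambda_{i,j}=1$ if $i$ is odd, $j$ is even and $i<j$; $\Lambda_{i,j}=-1$ if $i$ is even, $j$ is odd and $i>j$; $\Lambda_{i,j}=0$ otherwise. $\Lambda$ also denotes the bilinear form on $\mathbb{Z}^n$ with this matrix in the canonical basis $e_1,\dots,e_n$. Let $\nu$ be an indeterminate over $\mathbb{Z}$, $q=\nu^2$, $q^{\pm 1/2}=\nu^{\pm1}$. The based quantum torus $\mathcal{T}(\Lambda)$ is the $\mathbb{Z}[q^{\pm1/2}]$-algebra with basis $\{X^u\mid u\in\mathbb{Z}^n\}$ and product $X^uX^v=q^{\Lambda(u,v)/2}X^{u+v}$. It is an Ore domain and $\mathcal{F}(\Lambda)$ denotes its skew-field of fractions. Put $X_i=X^{e_i}$, $\mathbf{X}=(X_1,\dots,X_n)$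 and $\Sigma=(B,\Lambda,\mathbf{X})$ (the initial quantum seed). Quantum cluster variables (Berenstein--Zelevinsky). Quantum seeds are the triples $(B^*,\Lambda^*,\mathbf{Y})$ obtained from $\Sigma$ by finite sequences of mutations. For such a seed with $\mathbf{Y}=(Y_1,\dots,Y_n)$ one has $Y_iY_j=q^{\Lambda^*_{i,j}}Y_jY_i$, and one writes $Y^u=q^{-\frac12\sum_{i<j}\Lambda^*_{i,j}u_iu_j}Y_1^{u_1}\cdots Y_n^{u_n}$ for $u\in\mathbb{Z}^n$. Mutation in direction $k$ replaces $Y_k$ by $Y_k'=Y^{-e_k+\sum_i\max(b^*_{i,k},0)e_i}+Y^{-e_k+\sum_i\max(-b^*_{i,k},0)e_i}$, leaves the other $Y_i$ unchanged, replaces $B^*$ by its usual matrix mutation (entries $-b^*_{i,j}$ if $i=k$ or $j=k$, and $b^*_{i,j}+\frac12(|b^*_{i,k}|b^*_{k,j}+b^*_{i,k}|b^*_{k,j}|)$ otherwise), and replaces $\Lambda^*$ by the matrix of $q$-commutation exponents of the new cluster. The quantum cluster variables are all the elements $Y_i\in\mathcal{F}(\Lambda)$ of all clusters so obtained, and the quantum cluster algebra $\mathcal{A}_\Sigma$ is the $\mathbb{Z}[q^{\pm1/2}]$-subalgebra of $\mathcal{F}(\Lambda)$ they generate. Quantum frieze patterns. The repetition quiver $\mathbb{Z}Q$ has vertex set $Q_0\times\mathbb{Z}$ and arrows $(i,k)\to(j,l)$ whenever $k=l$ and $i\to j$ in $Q$, or $l=k+1$ and $j\to i$ in $Q$. A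 quantum frieze pattern on $\mathbb{Z}Q$ is a map $f:Q_0\times\mathbb{Z}\to\mathcal{F}(\Lambda)$ such that $$f(i,j)f(i,j+1)-q^{1/2}f(i-1,j+1)f(i+1,j)=1\quad\text{for all }(i,j)\in Q_0\times\mathbb{Z},$$ with the convention $f(0,j)=f(n+1,j)=1$ for all $j\in\mathbb{Z}$. The quantum frieze of variables associated with $Q$ is the unique quantum frieze pattern $f$ on $\mathbb{Z}Q$ with $f(i,0)=X_i$ for all $i\in Q_0$. Let $\phi$ be the automorphism of $\mathbb{Z}Q$ given by $\phi(i,j)=(n-i+1,\,j+i+1)$, and let $\Gamma=\mathbb{Z}Q/\langle\phi\rangle$. Its vertex set $\Gamma_0$ is identified with the fundamental domain $\{(i,j)\in Q_0\times\mathbb{Z}\mid j\ge0,\ i+j\le n+1\}$. A quantum frieze pattern $f$ on $\mathbb{Z}Q$ is said to induce a quantum frieze pattern on $\Gamma$ if $f(\phi(i,j))=f(i,j)$ for all $(i,j)\in Q_0\times\mathbb{Z}$. *)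

theory Defs
  imports Complex_Main "HOL-Library.Poly_Mapping"
begin

section \<open>Initial data\<close>

text \<open>Matrices are functions on index pairs, used only on \<open>{1..n} \<times> {1..n}\<close>.\<close>

definition B_init :: "nat \<Rightarrow> nat \<Rightarrow> nat \<Rightarrow> int" where
  "B_init n i j =
    (if i \<in> {1..n} \<and> j \<in> {1..n} then
       (if j = i + 1 then 1 else if i = j + 1 then -1 else 0) else 0)"

definition Lambda_init :: "nat \<Rightarrow> nat \<Rightarrow> nat \<Rightarrow> int" where
  "Lambda_init n i j =
    (if i \<in> {1..n} \<and> j \<in> {1..n} then
       (if odd i \<and> even j \<and> i < j then 1
        else if even i \<and> odd j \<and> i > j then -1 else 0) else 0)"

text \<open>For even \<open>n\<close> this is indeed the inverse of the transpose of the exchange matrix.\<close>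

lemma Lambda_init_times_transpose_B_init:
  assumes "even n" "i \<in> {1..n}" "k \<in> {1..n}"
  shows "(\<Sum>j = 1..n. Lambda_init n i j * B_init n k j) = (if i = k then 1 else 0)"
proof -
  have "Lambda_init n i j * B_init n k j =
      (if j = k + 1 then Lambda_init n i (k + 1) else 0)
      - (if j = k - 1 then Lambda_init n i (k - 1) else 0)" if "j \<in> {1..n}" for j
    using that assms(3) by (auto simp: B_init_def)
  then have "(\<Sum>j = 1..n. Lambda_init n i j * B_init n k j) =
      (\<Sum>j = 1..n. (if j = k + 1 then Lambda_init n i (k + 1) else 0)
      - (if j = k - 1 then Lambda_init n i (k - 1) else 0))"
    by (intro sum.cong) auto
  also have "\<dots> = Lambda_init n i (k + 1) - Lambda_init n i (k - 1)"
    using assms(3) by (auto simp: sum_subtractf Lambda_init_def)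
  also have "\<dots> = (if i = k then 1 else 0)"
    using assms unfolding Lambda_init_def by (auto; presburger)
  finally show ?thesis .
qed

section \<open>The based quantum torus and its skew-field of fractions\<close>

text \<open>
  Laurent polynomials in \<open>\<nu>\<close> over the integers are the group ring of the integers:
  \<open>Poly_Mapping.single k c\<close> is \<open>c \<nu>\<^sup>k\<close>, and multiplication is convolution. Recall \<open>q = \<nu>\<^sup>2\<close>.

  An element of the quantum torus is the finitely supported family of its coefficients with respect
  to the basis \<open>X\<^sup>u\<close>, where \<open>u\<close> has support in \<open>{1..n}\<close>. Its product is \<open>torus_mult\<close>;
  the product \<open>(*)\<close> that the type inherits from \<open>Poly_Mapping\<close> is the untwisted one
  and is not used.
\<close>

type_synonym laurent = "int \<Rightarrow>\<^sub>0 int"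
type_synonym torus = "(nat \<Rightarrow>\<^sub>0 int) \<Rightarrow>\<^sub>0 laurent"

definition nu_pow :: "int \<Rightarrow> laurent" where
  "nu_pow k = Poly_Mapping.single k 1"

definition Lambda_form :: "nat \<Rightarrow> (nat \<Rightarrow>\<^sub>0 int) \<Rightarrow> (nat \<Rightarrow>\<^sub>0 int) \<Rightarrow> int" where
  "Lambda_form n u v =
    (\<Sum>i = 1..n. \<Sum>j = 1..n. Poly_Mapping.lookup u i * Lambda_init n i j * Poly_Mapping.lookup v j)"

definition torus_carrier :: "nat \<Rightarrow> torus set" where
  "torus_carrier n = {a. \<forall>u \<in> Poly_Mapping.keys a. Poly_Mapping.keys u \<subseteq> {1..n}}"

definition torus_mult :: "nat \<Rightarrow> torus \<Rightarrow> torus \<Rightarrow> torus" where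
  "torus_mult n a b =
    (\<Sum>u \<in> Poly_Mapping.keys a. \<Sum>v \<in> Poly_Mapping.keys b.
       Poly_Mapping.single (u + v)
         (nu_pow (Lambda_form n u v) * Poly_Mapping.lookup a u * Poly_Mapping.lookup b v))"

definition torus_X :: "(nat \<Rightarrow>\<^sub>0 int) \<Rightarrow> torus" where
  "torus_X u = Poly_Mapping.single u 1"

definition torus_nu :: torus where
  "torus_nu = Poly_Mapping.single 0 (nu_pow 1)"

lemma torus_mult_X:
  "torus_mult n (torus_X u) (torus_X v) =
     Poly_Mapping.single (u + v) (nu_pow (Lambda_form n u v))"
  by (simp add: torus_mult_def torus_X_def)

text \<open>
  The type \<open>'a\<close>, embedded into by \<open>\<iota>\<close>, is a skew-field of fractions of the quantum torus.
  As the torus is an Ore domain, this determines \<open>('a, \<iota>)\<close> up to unique isomorphism.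
\<close>

definition skew_field_of_fractions :: "nat \<Rightarrow> (torus \<Rightarrow> 'a::division_ring) \<Rightarrow> bool" where
  "skew_field_of_fractions n \<iota> \<longleftrightarrow>
     \<iota> (torus_X 0) = 1 \<and>
     (\<forall>a \<in> torus_carrier n. \<forall>b \<in> torus_carrier n.
        \<iota> (a + b) = \<iota> a + \<iota> b \<and> \<iota> (torus_mult n a b) = \<iota> a * \<iota> b) \<and>
     inj_on \<iota> (torus_carrier n) \<and>
     (\<forall>z. \<exists>a \<in> torus_carrier n. \<exists>b \<in> torus_carrier n. b \<noteq> 0 \<and> z = \<iota> a * inverse (\<iota> b))"

definition X_init :: "(torus \<Rightarrow> 'a) \<Rightarrow> nat \<Rightarrow> 'a" where
  "X_init \<iota> i = \<iota> (torus_X (Poly_Mapping.single i 1))"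

section \<open>Quantum seeds and quantum cluster variables\<close>

text \<open>
  In the following, \<open>\<nu>\<close> is the image of the indeterminate in the skew-field, and a cluster is a
  function used only on \<open>{1..n}\<close>.
\<close>

definition cluster_monomial ::
  "nat \<Rightarrow> 'a::division_ring \<Rightarrow> (nat \<Rightarrow> nat \<Rightarrow> int) \<Rightarrow> (nat \<Rightarrow> 'a) \<Rightarrow> (nat \<Rightarrow> int) \<Rightarrow> 'a" where
  "cluster_monomial n \<nu> L Y u =
     \<nu> powi (- (\<Sum>i = 1..n. \<Sum>j = i + 1..n. L i j * u i * u j)) *
     prod_list (map (\<lambda>i. Y i powi u i) [1..<n + 1])"

definition mutate_B ::
  "nat \<Rightarrow> (nat \<Rightarrow> nat \<Rightarrow> int) \<Rightarrow> nat \<Rightarrow> nat \<Rightarrow> int" where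
  "mutate_B k B i j =
     (if i = k \<or> j = k then - B i j
      else B i j + (\<bar>B i k\<bar> * B k j + B i k * \<bar>B k j\<bar>) div 2)"

definition mutate_cluster ::
  "nat \<Rightarrow> 'a::division_ring \<Rightarrow> nat \<Rightarrow> (nat \<Rightarrow> nat \<Rightarrow> int) \<Rightarrow> (nat \<Rightarrow> nat \<Rightarrow> int) \<Rightarrow>
   (nat \<Rightarrow> 'a) \<Rightarrow> nat \<Rightarrow> 'a" where
  "mutate_cluster n \<nu> k B L Y =
     Y(k := cluster_monomial n \<nu> L Y (\<lambda>i. max (B i k) 0 - (if i = k then 1 else 0))
          + cluster_monomial n \<nu> L Y (\<lambda>i. max (- B i k) 0 - (if i = k then 1 else 0)))"

definition commutation_exponents ::
  "'a::division_ring \<Rightarrow> (nat \<Rightarrow> 'a) \<Rightarrow> nat \<Rightarrow> nat \<Rightarrow> int" where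
  "commutation_exponents \<nu> Y i j = (THE m. Y i * Y j = (\<nu>\<^sup>2) powi m * (Y j * Y i))"

inductive quantum_seed ::
  "nat \<Rightarrow> (torus \<Rightarrow> 'a::division_ring) \<Rightarrow>
   (nat \<Rightarrow> nat \<Rightarrow> int) \<Rightarrow> (nat \<Rightarrow> nat \<Rightarrow> int) \<Rightarrow> (nat \<Rightarrow> 'a) \<Rightarrow> bool"
  for n :: nat and \<iota> :: "torus \<Rightarrow> 'a" where
  initial: "quantum_seed n \<iota> (B_init n) (Lambda_init n) (X_init \<iota>)"
| mutation:
    "quantum_seed n \<iota> B L Y \<Longrightarrow> k \<in> {1..n} \<Longrightarrow>
     Y' = mutate_cluster n (\<iota> torus_nu) k B L Y \<Longrightarrow>
     quantum_seed n \<iota> (mutate_B k B) (commutation_exponents (\<iota> torus_nu) Y') Y'"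

definition quantum_cluster_variables :: "nat \<Rightarrow> (torus \<Rightarrow> 'a::division_ring) \<Rightarrow> 'a set" where
  "quantum_cluster_variables n \<iota> = {Y i | B L Y i. quantum_seed n \<iota> B L Y \<and> i \<in> {1..n}}"

section \<open>Quantum frieze patterns\<close>

definition ZQ_vertices :: "nat \<Rightarrow> (nat \<times> int) set" where
  "ZQ_vertices n = {1..n} \<times> UNIV"

definition frieze_value :: "nat \<Rightarrow> (nat \<times> int \<Rightarrow> 'a::one) \<Rightarrow> nat \<Rightarrow> int \<Rightarrow> 'a" where
  "frieze_value n f i j = (if i = 0 \<or> i = n + 1 then 1 else f (i, j))"

text \<open>A pattern is a function used only on the vertices of the repetition quiver.\<close>

definition quantum_frieze_pattern ::
  "nat \<Rightarrow> 'a::division_ring \<Rightarrow> (nat \<times> int \<Rightarrow> 'a) \<Rightarrow> bool" where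
  "quantum_frieze_pattern n \<nu> f \<longleftrightarrow>
     (\<forall>(i, j) \<in> ZQ_vertices n.
        frieze_value n f i j * frieze_value n f i (j + 1)
        - \<nu> * (frieze_value n f (i - 1) (j + 1) * frieze_value n f (i + 1) j) = 1)"

definition quantum_frieze_of_variables ::
  "nat \<Rightarrow> (torus \<Rightarrow> 'a::division_ring) \<Rightarrow> (nat \<times> int \<Rightarrow> 'a) \<Rightarrow> bool" where
  "quantum_frieze_of_variables n \<iota> f \<longleftrightarrow>
     quantum_frieze_pattern n (\<iota> torus_nu) f \<and> (\<forall>i \<in> {1..n}. f (i, 0) = X_init \<iota> i)"

definition phi :: "nat \<Rightarrow> nat \<times> int \<Rightarrow> nat \<times> int" where
  "phi n = (\<lambda>(i, j). (n - i + 1, j + int i + 1))"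

definition induces_frieze_pattern_on_Gamma :: "nat \<Rightarrow> (nat \<times> int \<Rightarrow> 'a) \<Rightarrow> bool" where
  "induces_frieze_pattern_on_Gamma n f \<longleftrightarrow> (\<forall>p \<in> ZQ_vertices n. f (phi n p) = f p)"

text \<open>The vertices of the quotient by \<open>phi\<close>, identified with a fundamental domain.\<close>

definition Gamma_vertices :: "nat \<Rightarrow> (nat \<times> int) set" where
  "Gamma_vertices n = {(i, j) \<in> ZQ_vertices n. j \<ge> 0 \<and> int i + j \<le> int n + 1}"

end

theory Submission
  imports Defs
begin

text \<open>
  Consider a convex polygon with vertices \<open>0, \<dots>, n + 2\<close>. The initial cluster variable \<open>X\<^sub>i\<close> is read as
  the lambda length of the diagonal from \<open>0\<close> to \<open>i + 1\<close>, and all sides have lambda length \<open>1\<close>.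
  Commutatively, the chord from \<open>a \<ge> 1\<close> to \<open>b > a\<close> then has lambda length
  \<open>y\<^sub>a y\<^sub>b (\<Sum>a \<le> k < b. 1 / (y\<^sub>k y\<^sub>k\<^sub>+\<^sub>1))\<close>, where \<open>y\<^sub>k\<close> is the length of the chord from \<open>0\<close> to \<open>k\<close>.
  The quantum lambda length is obtained by replacing every term of this sum by the basis element of the
  quantum torus with the same exponent. It is therefore an explicit element of the torus, which makes
  it easy to see that lambda lengths are nonzero and that distinct diagonals have distinct ones.

  Two families of relations carry the proof. Chords that do not cross quasi-commute
  (\<open>lambda_length_commute\<close>), and the diagonals of a quadrilateral satisfy a quantum Ptolemy relation
  (\<open>quantum_ptolemy\<close>). Both compare double sums of torus monomials. The two sides contain the same
  monomials, and the powers of \<open>\<nu>\<close> agree because the form \<open>\<Lambda>\<close> has closed values on the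
  exponents in question: with \<open>E\<^sub>a\<close> the exponent of \<open>y\<^sub>a\<close> and \<open>F\<^sub>k = E\<^sub>k + E\<^sub>k\<^sub>+\<^sub>1\<close>, the value \<open>\<Lambda>(E\<^sub>a, F\<^sub>k)\<close>
  depends on \<open>k\<close> only through the truth of \<open>a \<le> k\<close>, and \<open>\<Lambda>(F\<^sub>k, F\<^sub>l)\<close> is the sign of \<open>l - k\<close>.

  Every quantum seed is described by a triangulation whose diagonals are labelled by \<open>1, \<dots>, n\<close>: the
  cluster consists of the lambda lengths of the diagonals, and each column of the exchange matrix lists the
  sides of the quadrilateral around a diagonal with alternating signs. A mutation flips that diagonal, the
  exchange relation being exactly the quantum Ptolemy relation (\<open>seed_flip\<close>). Since every diagonal is
  reached by flips from the fan at \<open>0\<close>, the quantum cluster variables are the lambda lengths of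
  the diagonals (\<open>quantum_cluster_variables_eq\<close>).

  On the other side, sending \<open>(i, j)\<close> to the lambda length of the chord from \<open>j\<close> to \<open>j + i + 1\<close>, read modulo
  \<open>n + 3\<close>, is a quantum frieze pattern: the frieze rule is the quantum Ptolemy relation for a
  quadrilateral with two opposite sides on the boundary (\<open>polygon_frieze_pattern\<close>). As its values are
  nonzero, it is the only pattern with the given initial slice (\<open>frieze_pattern_unique\<close>). The
  automorphism \<open>phi\<close> merely exchanges the two ends of a chord, and the fundamental domain lists every
  diagonal once.
\<close>

section \<open>Monomials in quasi-commuting clusters\<close>

lemma cluster_monomial_cong:
  assumes "\<And>i. i \<in> {1..n} \<Longrightarrow> u i = v i"
  shows "cluster_monomial n \<nu> L Y u = cluster_monomial n \<nu> L Y v"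
proof -
  have "(\<Sum>i = 1..n. \<Sum>j = i + 1..n. L i j * u i * u j) = (\<Sum>i = 1..n. \<Sum>j = i + 1..n. L i j * v i * v j)"
    using assms by (intro sum.cong refl) auto
  moreover have "map (\<lambda>i. Y i powi u i) [1..<n + 1] = map (\<lambda>i. Y i powi v i) [1..<n + 1]"
    using assms by (intro map_cong refl) auto
  ultimately show ?thesis unfolding cluster_monomial_def by (simp only:)
qed

text \<open>
  Multiplying monomials in a quasi-commuting cluster uses of \<open>\<nu>\<close> only that it is central and
  invertible.
\<close>

locale central_unit =
  fixes \<nu> :: "'a::division_ring"
  assumes unit_nonzero: "\<nu> \<noteq> 0" and unit_central: "\<nu> * z = z * \<nu>"
begin

lemma unit_powi_central: "\<nu> powi m * z = z * \<nu> powi m"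
proof -
  have pow: "\<nu> ^ k * z = z * \<nu> ^ k" for k z
    by (induction k) (simp_all add: mult.assoc, metis mult.assoc unit_central)
  have inv: "inverse c * z = z * inverse c" if "c * z = z * c" "c \<noteq> 0" for c z :: 'a
    using that by (metis (no_types, lifting) left_inverse mult.assoc mult_1_left mult_1_right right_inverse)
  show ?thesis
    by (cases m rule: int_cases2) (simp_all add: pow inv power_int_minus unit_nonzero)
qed

lemma unit_powi_add: "\<nu> powi (a + b) = \<nu> powi a * \<nu> powi b"
  using unit_nonzero by (simp add: power_int_add)

lemma unit_powi_times_unit_powi: "\<nu> powi a * (\<nu> powi b * z) = \<nu> powi (a + b) * z"
  by (simp add: unit_powi_add mult.assoc)

lemma collect_unit_powi: "(\<nu> powi a * x) * (\<nu> powi b * y) = \<nu> powi (a + b) * (x * y)"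
proof -
  have "(\<nu> powi a * x) * (\<nu> powi b * y) = \<nu> powi a * ((x * \<nu> powi b) * y)"
    by (simp only: mult.assoc)
  also have "x * \<nu> powi b = \<nu> powi b * x" by (simp only: unit_powi_central)
  finally show ?thesis by (simp only: mult.assoc unit_powi_add)
qed

text \<open>
  The exponent is counted in powers of \<open>\<nu>\<close>, so an exponent \<open>m\<close> of \<open>q\<close> appears as \<open>2 * m\<close>.
\<close>

definition q_commute :: "int \<Rightarrow> 'a \<Rightarrow> 'a \<Rightarrow> bool" where
  "q_commute m x y \<longleftrightarrow> x * y = \<nu> powi m * (y * x)"

lemma q_commute_sym: "q_commute m x y \<Longrightarrow> q_commute (- m) y x"
  unfolding q_commute_def by (simp add: unit_powi_times_unit_powi)

lemma q_commute_one: "q_commute 0 x 1"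
  by (simp add: q_commute_def)

lemma q_commute_mult:
  assumes "q_commute m x y" "q_commute m' x y'"
  shows "q_commute (m + m') x (y * y')"
proof -
  have "x * (y * y') = (\<nu> powi m * y) * (x * y')"
    using assms(1) by (simp add: q_commute_def mult.assoc[symmetric])
  also have "\<dots> = (\<nu> powi m * y) * (\<nu> powi m' * (y' * x))"
    using assms(2) by (simp add: q_commute_def)
  finally show ?thesis unfolding collect_unit_powi by (simp add: q_commute_def mult.assoc)
qed

lemma q_commute_inverse:
  assumes "q_commute m x y" "y \<noteq> 0"
  shows "q_commute (- m) x (inverse y)"
proof -
  have "inverse y * (x * y) * inverse y = inverse y * (\<nu> powi m * (y * x)) * inverse y"
    using assms(1) by (simp add: q_commute_def)
  then have "inverse y * x = \<nu> powi m * (x * inverse y)"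
    using assms(2)
    by (metis (no_types, lifting) left_inverse mult.assoc mult_1_left mult_1_right right_inverse
        unit_powi_central)
  then show ?thesis by (simp add: q_commute_def unit_powi_times_unit_powi)
qed

lemma q_commute_powi_right:
  assumes "q_commute m x y" "y \<noteq> 0"
  shows "q_commute (m * r) x (y powi r)"
proof -
  have pow: "q_commute (m * int k) x (y ^ k)" for k
  proof (induction k)
    case (Suc k)
    then show ?case
      using q_commute_mult[OF assms(1) Suc] by (simp add: algebra_simps)
  qed (simp add: q_commute_one)
  show ?thesis
    using pow q_commute_inverse[OF pow] assms(2)
    by (cases r rule: int_cases2) (simp_all add: power_int_minus)
qed

lemma q_commute_powi:
  assumes "q_commute m x y" "x \<noteq> 0" "y \<noteq> 0"
  shows "q_commute (m * p * r) (x powi p) (y powi r)"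
proof -
  have "q_commute (- m * p) y (x powi p)"
    using q_commute_powi_right[OF q_commute_sym] assms by blast
  then have "q_commute (m * p) (x powi p) y"
    using q_commute_sym by fastforce
  then show ?thesis using q_commute_powi_right assms by blast
qed

lemma q_commute_cluster_product:
  assumes "\<And>i. i \<in> {1..m} \<Longrightarrow> q_commute (c i) x (Y i)" "\<And>i. i \<in> {1..m} \<Longrightarrow> Y i \<noteq> 0"
  shows "q_commute (\<Sum>i = 1..m. c i * v i) x (prod_list (map (\<lambda>i. Y i powi v i) [1..<m + 1]))"
  using assms
proof (induction m)
  case (Suc m)
  have "q_commute (c (Suc m) * v (Suc m)) x (Y (Suc m) powi v (Suc m))"
    using Suc.prems by (intro q_commute_powi_right) auto
  with q_commute_mult[OF Suc.IH this] Suc.prems show ?case by simp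
qed (simp add: q_commute_one)

text \<open>
  Splitting off the last factor makes induction on the length of the cluster possible.
\<close>

lemma cluster_monomial_Suc:
  "cluster_monomial (Suc m) \<nu> L Y u =
     \<nu> powi (- (\<Sum>i = 1..m. L i (Suc m) * u i * u (Suc m))) *
     (cluster_monomial m \<nu> L Y u * Y (Suc m) powi u (Suc m))"
proof -
  have "(\<Sum>i = 1..Suc m. \<Sum>j = i + 1..Suc m. L i j * u i * u j) =
      (\<Sum>i = 1..m. (\<Sum>j = i + 1..m. L i j * u i * u j) + L i (Suc m) * u i * u (Suc m))"
    by (simp add: sum.cl_ivl_Suc)
  then show ?thesis
    by (simp add: cluster_monomial_def sum.distrib unit_powi_times_unit_powi mult.assoc
        add.commute)
qed

text \<open>
  The normalising power of \<open>\<nu>\<close> makes the monomials in any quasi-commuting cluster multiply like the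
  basis of a based quantum torus. This replaces all bookkeeping about the order of the factors.
\<close>

lemma cluster_monomial_mult:
  assumes comm: "\<And>i j. i \<in> {1..m} \<Longrightarrow> j \<in> {1..m} \<Longrightarrow> q_commute (2 * L i j) (Y i) (Y j)"
    and nz: "\<And>i. i \<in> {1..m} \<Longrightarrow> Y i \<noteq> 0"
    and skew: "\<And>i j. i \<in> {1..m} \<Longrightarrow> j \<in> {1..m} \<Longrightarrow> L j i = - L i j"
  shows "cluster_monomial m \<nu> L Y u * cluster_monomial m \<nu> L Y v =
    \<nu> powi (\<Sum>i = 1..m. \<Sum>j = 1..m. L i j * u i * v j) *
    cluster_monomial m \<nu> L Y (\<lambda>i. u i + v i)"
  using assms
proof (induction m)
  case 0
  show ?case by (simp add: cluster_monomial_def)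
next
  case (Suc m)
  let ?s = "Suc m"
  let ?M = "cluster_monomial m \<nu> L Y"
  let ?p = "\<lambda>w. Y ?s powi w ?s"
  let ?c = "\<lambda>w. - (\<Sum>i = 1..m. L i ?s * w i * w ?s)"
  let ?d = "2 * (\<Sum>i = 1..m. L ?s i * u ?s * v i)"
  have L0: "L ?s ?s = 0" using Suc.prems(3)[of ?s ?s] by simp
  have IH: "?M u * ?M v = \<nu> powi (\<Sum>i = 1..m. \<Sum>j = 1..m. L i j * u i * v j) * ?M (\<lambda>i. u i + v i)"
    by (rule Suc.IH) (use Suc.prems(1,2) in auto, rule Suc.prems(3), auto)
  have "q_commute (\<Sum>i = 1..m. (2 * L ?s i * u ?s) * v i) (?p u)
      (prod_list (map (\<lambda>i. Y i powi v i) [1..<m + 1]))"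
  proof (rule q_commute_cluster_product)
    fix i assume i: "i \<in> {1..m}"
    have "q_commute (2 * L ?s i * u ?s * 1) (Y ?s powi u ?s) (Y i powi 1)"
      using i Suc.prems(1,2) by (intro q_commute_powi) auto
    then show "q_commute (2 * L ?s i * u ?s) (?p u) (Y i)" by simp
  qed (use Suc.prems(2) in auto)
  then have d: "q_commute ?d (?p u) (?M v)"
  proof -
    assume "q_commute (\<Sum>i = 1..m. (2 * L ?s i * u ?s) * v i) (?p u)
      (prod_list (map (\<lambda>i. Y i powi v i) [1..<m + 1]))"
    then have "q_commute (0 + (\<Sum>i = 1..m. (2 * L ?s i * u ?s) * v i)) (?p u) (?M v)"
      unfolding cluster_monomial_def
      by (intro q_commute_mult) (simp_all add: q_commute_def unit_powi_central)
    then show ?thesis by (simp add: sum_distrib_left mult.assoc)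
  qed
  \<comment> \<open>The last factor of the first monomial is carried across the whole shorter second monomial.\<close>
  have "cluster_monomial ?s \<nu> L Y u * cluster_monomial ?s \<nu> L Y v =
      \<nu> powi (?c u + ?c v) * ((?M u * ?p u) * (?M v * ?p v))"
    by (simp only: cluster_monomial_Suc collect_unit_powi)
  also have "(?M u * ?p u) * (?M v * ?p v) = ?M u * ((?p u * ?M v) * ?p v)"
    by (simp only: mult.assoc)
  also have "?p u * ?M v = \<nu> powi ?d * (?M v * ?p u)"
    using d by (simp only: q_commute_def)
  also have "?M u * ((\<nu> powi ?d * (?M v * ?p u)) * ?p v) = \<nu> powi ?d * ((?M u * ?M v) * (?p u * ?p v))"
  proof -
    have "?M u * (\<nu> powi ?d * z) = \<nu> powi ?d * (?M u * z)" for z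
      using unit_powi_central[of ?d "?M u"] by (simp only: mult.assoc[symmetric])
    then show ?thesis by (simp only: mult.assoc)
  qed
  also have "?p u * ?p v = ?p (\<lambda>i. u i + v i)"
    using Suc.prems(2)[of ?s] by (simp add: power_int_add)
  also have "\<nu> powi (?c u + ?c v) * (\<nu> powi ?d * (?M u * ?M v * ?p (\<lambda>i. u i + v i))) =
      \<nu> powi (?c u + ?c v + ?d + (\<Sum>i = 1..m. \<Sum>j = 1..m. L i j * u i * v j)) *
        (?M (\<lambda>i. u i + v i) * ?p (\<lambda>i. u i + v i))"
    by (simp only: IH unit_powi_times_unit_powi mult.assoc add.assoc)
  also have "?c u + ?c v + ?d + (\<Sum>i = 1..m. \<Sum>j = 1..m. L i j * u i * v j) =
      (\<Sum>i = 1..?s. \<Sum>j = 1..?s. L i j * u i * v j) + ?c (\<lambda>i. u i + v i)"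
  proof -
    have e: "(\<Sum>i = 1..m. L ?s i * w i) = - (\<Sum>i = 1..m. L i ?s * w i)" for w
      unfolding sum_negf[symmetric]
      by (intro sum.cong refl) (subst Suc.prems(3), auto)
    have "(\<Sum>i = 1..m. L ?s i * u ?s * v i) = - (\<Sum>i = 1..m. L i ?s * (u ?s * v i))"
      using e[of "\<lambda>i. u ?s * v i"] by (simp add: mult.assoc)
    then show ?thesis
      by (simp add: L0 sum.distrib algebra_simps sum_distrib_left)
  qed
  finally show ?case
    by (simp only: cluster_monomial_Suc[of m L Y "\<lambda>i. u i + v i"] unit_powi_times_unit_powi)
qed

lemma cluster_monomial_zero: "cluster_monomial m \<nu> L Y (\<lambda>_. 0) = 1"
  by (simp add: cluster_monomial_def map_replicate_const del: upt_Suc)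

lemma cluster_monomial_unit:
  assumes "k \<in> {1..m}"
  shows "cluster_monomial m \<nu> L Y (\<lambda>i. if i = k then 1 else 0) = Y k"
proof -
  have 0: "(\<Sum>i = 1..m. \<Sum>j = i + 1..m. L i j * (if i = k then 1 else 0) * (if j = k then 1 else 0)) = (0::int)"
    by (intro sum.neutral ballI) auto
  have one: "prod_list (map (\<lambda>i. Y i powi (if i = k then 1 else 0)) xs) = 1" if "k \<notin> set xs" for xs
    using that by (induction xs) auto
  have "[1..<m + 1] = [1..<k] @ k # [k + 1..<m + 1]"
    using assms upt_add_eq_append[of 1 k "m + 1 - k"] by (simp add: upt_conv_Cons del: upt_Suc)
  then have "prod_list (map (\<lambda>i. Y i powi (if i = k then 1 else 0)) [1..<m + 1]) = Y k"
    by (simp add: one del: upt_Suc)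
  then show ?thesis unfolding cluster_monomial_def 0 by simp
qed

end

section \<open>The quantum torus inside its skew-field of fractions\<close>

lemma Lambda_form_add_left: "Lambda_form n (u + u') v = Lambda_form n u v + Lambda_form n u' v"
  by (simp add: Lambda_form_def lookup_add algebra_simps sum.distrib)

lemma Lambda_form_add_right: "Lambda_form n u (v + v') = Lambda_form n u v + Lambda_form n u v'"
  by (simp add: Lambda_form_def lookup_add algebra_simps sum.distrib)

lemma Lambda_form_diff_left: "Lambda_form n (u - u') v = Lambda_form n u v - Lambda_form n u' v"
  by (simp add: Lambda_form_def lookup_minus algebra_simps sum_subtractf)

lemma Lambda_form_diff_right: "Lambda_form n u (v - v') = Lambda_form n u v - Lambda_form n u v'"
  by (simp add: Lambda_form_def lookup_minus algebra_simps sum_subtractf)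

lemma Lambda_form_zero [simp]: "Lambda_form n 0 v = 0" "Lambda_form n u 0 = 0"
  by (simp_all add: Lambda_form_def)

lemma Lambda_form_skew: "Lambda_form n u v = - Lambda_form n v u"
proof -
  have "Lambda_form n u v = (\<Sum>j = 1..n. \<Sum>i = 1..n.
      Poly_Mapping.lookup u i * Lambda_init n i j * Poly_Mapping.lookup v j)"
    unfolding Lambda_form_def by (rule sum.swap)
  also have "\<dots> = - Lambda_form n v u"
    unfolding Lambda_form_def sum_negf[symmetric]
    by (intro sum.cong refl) (auto simp: Lambda_init_def)
  finally show ?thesis .
qed

lemma Lambda_form_single:
  assumes "i \<in> {1..n}" "j \<in> {1..n}"
  shows "Lambda_form n (Poly_Mapping.single i 1) (Poly_Mapping.single j 1) = Lambda_init n i j"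
proof -
  have "Lambda_form n (Poly_Mapping.single i 1) (Poly_Mapping.single j 1) =
      (\<Sum>i' = 1..n. \<Sum>j' = 1..n. if j = j' then (if i = i' then Lambda_init n i' j' else 0) else 0)"
    unfolding Lambda_form_def by (intro sum.cong refl) (auto simp: lookup_single when_def)
  then show ?thesis using assms by simp
qed

definition supported :: "nat \<Rightarrow> (nat \<Rightarrow>\<^sub>0 int) \<Rightarrow> bool" where
  "supported n u \<longleftrightarrow> Poly_Mapping.keys u \<subseteq> {1..n}"

lemma supported_zero [simp]: "supported n 0"
  and supported_single [simp]: "i \<in> {1..n} \<Longrightarrow> supported n (Poly_Mapping.single i c)"
  by (auto simp: supported_def)

lemma supported_add [simp]: "supported n u \<Longrightarrow> supported n v \<Longrightarrow> supported n (u + v)"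
  using keys_add[of u v] by (auto simp: supported_def)

lemma supported_diff [simp]: "supported n u \<Longrightarrow> supported n v \<Longrightarrow> supported n (u - v)"
  unfolding supported_def in_keys_iff lookup_minus subset_iff by (metis diff_self)

lemma zero_in_torus_carrier [simp]: "0 \<in> torus_carrier n"
  by (simp add: torus_carrier_def)

lemma torus_X_in_torus_carrier: "torus_X u \<in> torus_carrier n \<longleftrightarrow> supported n u"
  by (auto simp: torus_carrier_def torus_X_def supported_def)

lemma single_zero_in_torus_carrier [simp]: "Poly_Mapping.single 0 c \<in> torus_carrier n"
  by (auto simp: torus_carrier_def)

lemma torus_carrier_add: "a \<in> torus_carrier n \<Longrightarrow> b \<in> torus_carrier n \<Longrightarrow> a + b \<in> torus_carrier n"
  using keys_add[of a b] by (auto simp: torus_carrier_def)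

lemma torus_carrier_sum: "(\<And>k. k \<in> K \<Longrightarrow> t k \<in> torus_carrier n) \<Longrightarrow> sum t K \<in> torus_carrier n"
  by (induction K rule: infinite_finite_induct) (auto intro: torus_carrier_add)

text \<open>
  A coefficient in exponent \<open>0\<close> acts by scalar multiplication from either side, because \<open>\<Lambda>\<close> vanishes
  there; as the coefficient ring is commutative, such elements are central.
\<close>

lemma torus_mult_single_zero_left:
  "torus_mult n (Poly_Mapping.single 0 c) a =
     (\<Sum>v \<in> Poly_Mapping.keys a. Poly_Mapping.single v (c * Poly_Mapping.lookup a v))"
  by (cases "c = 0") (simp_all add: torus_mult_def nu_pow_def)

lemma torus_mult_single_zero_right:
  "torus_mult n a (Poly_Mapping.single 0 c) =
     (\<Sum>v \<in> Poly_Mapping.keys a. Poly_Mapping.single v (Poly_Mapping.lookup a v * c))"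
  by (cases "c = 0") (simp_all add: torus_mult_def nu_pow_def)

lemma nu_pow_add: "nu_pow (a + b) = nu_pow a * nu_pow b"
  by (simp add: nu_pow_def mult_single)

locale torus_fractions =
  fixes n :: nat and \<iota> :: "torus \<Rightarrow> 'a::division_ring"
  assumes n_even: "even n" and fractions: "skew_field_of_fractions n \<iota>"
begin

abbreviation \<nu> :: 'a where "\<nu> \<equiv> \<iota> torus_nu"

definition torus_monomial :: "(nat \<Rightarrow>\<^sub>0 int) \<Rightarrow> 'a" where
  "torus_monomial u = \<iota> (torus_X u)"

lemma \<iota>_add: "a \<in> torus_carrier n \<Longrightarrow> b \<in> torus_carrier n \<Longrightarrow> \<iota> (a + b) = \<iota> a + \<iota> b"
  and \<iota>_mult: "a \<in> torus_carrier n \<Longrightarrow> b \<in> torus_carrier n \<Longrightarrow> \<iota> (torus_mult n a b) = \<iota> a * \<iota> b"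
  and \<iota>_inj: "inj_on \<iota> (torus_carrier n)"
  and torus_monomial_zero: "torus_monomial 0 = 1"
  using fractions by (auto simp: skew_field_of_fractions_def torus_monomial_def)

lemma \<iota>_zero: "\<iota> 0 = 0"
  using \<iota>_add[of 0 0] by simp

lemma \<iota>_eq_zero_iff: "a \<in> torus_carrier n \<Longrightarrow> \<iota> a = 0 \<longleftrightarrow> a = 0"
  using inj_on_eq_iff[OF \<iota>_inj, of a 0] by (simp add: \<iota>_zero)

lemma \<iota>_sum: "(\<And>k. k \<in> K \<Longrightarrow> t k \<in> torus_carrier n) \<Longrightarrow> \<iota> (sum t K) = (\<Sum>k \<in> K. \<iota> (t k))"
  by (induction K rule: infinite_finite_induct) (auto simp: \<iota>_zero \<iota>_add torus_carrier_sum)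

lemma \<nu>_nonzero: "\<nu> \<noteq> 0"
proof -
  have "torus_nu \<noteq> 0"
    unfolding torus_nu_def nu_pow_def by (metis lookup_single_eq lookup_zero zero_neq_one)
  then show ?thesis
    using \<iota>_eq_zero_iff[of torus_nu] by (simp add: torus_nu_def)
qed

text \<open>
  Every element of the skew-field is a right fraction, so it suffices that \<open>\<nu>\<close> commutes with the
  image of the torus.
\<close>

lemma \<nu>_central: "\<nu> * z = z * \<nu>"
proof -
  obtain a b where ab: "a \<in> torus_carrier n" "b \<in> torus_carrier n" "b \<noteq> 0" "z = \<iota> a * inverse (\<iota> b)"
    using fractions unfolding skew_field_of_fractions_def by metis
  have comm: "\<nu> * \<iota> c = \<iota> c * \<nu>" if "c \<in> torus_carrier n" for c
    using that
    by (simp add: \<iota>_mult[symmetric] torus_nu_def torus_mult_single_zero_left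
        torus_mult_single_zero_right mult.commute)
  have "\<iota> b \<noteq> 0" using ab \<iota>_eq_zero_iff by blast
  then have "\<nu> * inverse (\<iota> b) = inverse (\<iota> b) * \<nu>"
    using comm[OF ab(2)]
    by (metis (no_types, lifting) left_inverse mult.assoc mult_1_left mult_1_right right_inverse)
  then show ?thesis using comm[OF ab(1)] ab(4) by (metis mult.assoc)
qed

sublocale central_unit \<nu>
  by standard (fact \<nu>_nonzero, fact \<nu>_central)

lemma \<nu>_powi_eq: "\<nu> powi m = \<iota> (Poly_Mapping.single 0 (nu_pow m))"
proof -
  let ?N = "\<lambda>m. \<iota> (Poly_Mapping.single 0 (nu_pow m))"
  have add: "?N (a + b) = ?N a * ?N b" for a b
  proof -
    have "nu_pow b \<noteq> 0" unfolding nu_pow_def by (metis lookup_single_eq lookup_zero zero_neq_one)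
    then show ?thesis
      by (simp add: \<iota>_mult[symmetric] torus_mult_single_zero_left nu_pow_add)
  qed
  have zero: "?N 0 = 1"
    using torus_monomial_zero by (simp add: torus_monomial_def torus_X_def nu_pow_def)
  have one: "?N 1 = \<nu>" by (simp add: torus_nu_def)
  have pos: "?N (int k) = \<nu> ^ k" for k
    using zero by (induction k) (simp_all add: add one)
  have "?N (- int k) * ?N (int k) = 1" for k
    using add[of "- int k" "int k"] zero by simp
  then have neg: "?N (- int k) = inverse (\<nu> ^ k)" for k
    by (metis pos inverse_unique inverse_inverse_eq inverse_eq_imp_eq)
  show ?thesis
    by (cases m rule: int_cases2) (simp_all add: pos neg power_int_minus)
qed

text \<open>
  This makes commutation exponents between nonzero elements unique.
\<close>

lemma \<nu>_powi_inject: "\<nu> powi a = \<nu> powi b \<longleftrightarrow> a = b"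
proof
  assume "\<nu> powi a = \<nu> powi b"
  then have "Poly_Mapping.single (0 :: nat \<Rightarrow>\<^sub>0 int) (nu_pow a) = Poly_Mapping.single 0 (nu_pow b)"
    unfolding \<nu>_powi_eq using \<iota>_inj by (simp add: inj_on_def)
  then have "nu_pow a = nu_pow b" by (metis lookup_single_eq)
  then have "(1 when a = a) = (1 when b = a :: int)"
    unfolding nu_pow_def by (metis lookup_single)
  then show "a = b" by (auto simp: when_def split: if_splits)
qed simp

lemma torus_monomial_mult:
  assumes "supported n u" "supported n v"
  shows "torus_monomial u * torus_monomial v = \<nu> powi (Lambda_form n u v) * torus_monomial (u + v)"
proof -
  have "torus_monomial u * torus_monomial v = \<iota> (Poly_Mapping.single (u + v) (nu_pow (Lambda_form n u v)))"
    using assms by (simp add: torus_monomial_def \<iota>_mult[symmetric] torus_X_in_torus_carrier torus_mult_X)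
  also have "Poly_Mapping.single (u + v) (nu_pow (Lambda_form n u v)) =
      torus_mult n (Poly_Mapping.single 0 (nu_pow (Lambda_form n u v))) (torus_X (u + v))"
    by (simp add: torus_mult_single_zero_left torus_X_def)
  also have "\<iota> \<dots> = \<nu> powi (Lambda_form n u v) * torus_monomial (u + v)"
    using assms by (simp add: \<iota>_mult torus_X_in_torus_carrier torus_monomial_def \<nu>_powi_eq)
  finally show ?thesis .
qed

end

section \<open>Quantum lambda lengths\<close>

text \<open>
  Vertex \<open>a\<close> stands for the exponent of the lambda length of the chord from \<open>0\<close> to \<open>a\<close>. The chords to the
  neighbours \<open>1\<close> and \<open>n + 2\<close> are sides, of length \<open>1\<close>, and have exponent \<open>0\<close>.
\<close>

definition vertex_exp :: "nat \<Rightarrow> nat \<Rightarrow> (nat \<Rightarrow>\<^sub>0 int)" where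
  "vertex_exp n a = (if a \<in> {2..n + 1} then Poly_Mapping.single (a - 1) 1 else 0)"

definition edge_exp :: "nat \<Rightarrow> nat \<Rightarrow> (nat \<Rightarrow>\<^sub>0 int)" where
  "edge_exp n k = vertex_exp n k + vertex_exp n (k + 1)"

definition term_exp :: "nat \<Rightarrow> nat \<Rightarrow> nat \<Rightarrow> nat \<Rightarrow> (nat \<Rightarrow>\<^sub>0 int)" where
  "term_exp n a b k = vertex_exp n a + vertex_exp n b - edge_exp n k"

text \<open>
  A chord at \<open>0\<close> gets the single term \<open>k = 0\<close>, so that \<open>term_exp n 0 b 0\<close> is the exponent of \<open>b\<close>. With this
  convention the formulas below hold for all chords alike.
\<close>

definition term_range :: "nat \<Rightarrow> nat \<Rightarrow> nat set" where
  "term_range a b = (if a = 0 then {0} else {a..<b})"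

definition chord_torus :: "nat \<Rightarrow> nat \<Rightarrow> nat \<Rightarrow> torus" where
  "chord_torus n a b = (\<Sum>k \<in> term_range a b. torus_X (term_exp n a b k))"

text \<open>
  These four functions are the values of \<open>\<Lambda>\<close> on vertex exponents, on a vertex and an edge exponent, on
  edge exponents and on term exponents. The first three are wrong at the index \<open>0\<close>, whose exponent vanishes,
  but the errors cancel in the fourth: there a vertex \<open>0\<close> occurs only together with the edge index \<open>0\<close>,
  as if \<open>0\<close> had an exponent of its own.
\<close>

definition vertex_pairing :: "nat \<Rightarrow> nat \<Rightarrow> int" where
  "vertex_pairing a b = (if even a \<and> odd b \<and> a < b then 1 else if odd a \<and> even b \<and> b < a then -1 else 0)"

definition vertex_edge_pairing :: "nat \<Rightarrow> nat \<Rightarrow> int" where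
  "vertex_edge_pairing a k = of_bool (a \<le> k) - of_bool (odd a)"

definition edge_pairing :: "nat \<Rightarrow> nat \<Rightarrow> int" where
  "edge_pairing k l = of_bool (k < l) - of_bool (l < k)"

definition term_pairing :: "nat \<Rightarrow> nat \<Rightarrow> nat \<Rightarrow> nat \<Rightarrow> nat \<Rightarrow> nat \<Rightarrow> int" where
  "term_pairing a b k c d l = vertex_pairing a c + vertex_pairing a d + vertex_pairing b c + vertex_pairing b d - vertex_edge_pairing a l - vertex_edge_pairing b l + vertex_edge_pairing c k + vertex_edge_pairing d k + edge_pairing k l"

lemmas pairing_defs = term_pairing_def vertex_pairing_def vertex_edge_pairing_def edge_pairing_def

lemma supported_vertex_exp [simp]: "supported n (vertex_exp n a)"
  unfolding vertex_exp_def by (simp, intro impI supported_single) auto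

lemma supported_term_exp [simp]: "supported n (term_exp n a b k)"
  by (simp add: term_exp_def edge_exp_def)

lemma vertex_exp_simps [simp]:
  "vertex_exp n 0 = 0" "vertex_exp n (Suc 0) = 0" "vertex_exp n (Suc (Suc n)) = 0"
  by (simp_all add: vertex_exp_def)

lemma Lambda_vertex_vertex:
  assumes "even n" "1 \<le> a" "1 \<le> b" "a \<le> n + 2" "b \<le> n + 2"
  shows "Lambda_form n (vertex_exp n a) (vertex_exp n b) = vertex_pairing a b"
proof (cases "a \<in> {2..n + 1} \<and> b \<in> {2..n + 1}")
  case True
  then have "Lambda_form n (vertex_exp n a) (vertex_exp n b) = Lambda_init n (a - 1) (b - 1)"
    by (subst Lambda_form_single[symmetric]) (auto simp: vertex_exp_def)
  then show ?thesis
    using True by (auto simp: Lambda_init_def vertex_pairing_def)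
next
  case False
  then have "Lambda_form n (vertex_exp n a) (vertex_exp n b) = 0"
    by (auto simp: vertex_exp_def)
  moreover have "vertex_pairing a b = 0"
  proof -
    have "a = 1 \<or> a = n + 2 \<or> b = 1 \<or> b = n + 2" using False assms by auto
    then show ?thesis using assms by (auto simp: vertex_pairing_def)
  qed
  ultimately show ?thesis by simp
qed

text \<open>
  Of the neighbours \<open>k\<close> and \<open>k + 1\<close> exactly one has the parity opposite to \<open>a\<close>, so the sum of
  their two pairings with \<open>a\<close> depends only on the side of \<open>a\<close> on which the edge lies.
\<close>

lemma Lambda_vertex_edge:
  assumes "even n" "1 \<le> a" "1 \<le> k" "a \<le> n + 2" "k \<le> n + 1"
  shows "Lambda_form n (vertex_exp n a) (edge_exp n k) = vertex_edge_pairing a k"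
proof -
  have "Lambda_form n (vertex_exp n a) (edge_exp n k) = vertex_pairing a k + vertex_pairing a (k + 1)"
    using assms by (simp add: edge_exp_def Lambda_form_add_right Lambda_vertex_vertex)
  also have "\<dots> = vertex_edge_pairing a k"
    by (cases "even a"; cases "even k") (auto simp: vertex_pairing_def vertex_edge_pairing_def not_less le_Suc_eq)
  finally show ?thesis .
qed

lemma Lambda_edge_edge:
  assumes "even n" "1 \<le> k" "1 \<le> l" "k \<le> n + 1" "l \<le> n + 1"
  shows "Lambda_form n (edge_exp n k) (edge_exp n l) = edge_pairing k l"
proof -
  have "Lambda_form n (edge_exp n k) (edge_exp n l) = vertex_edge_pairing k l + vertex_edge_pairing (k + 1) l"
    using assms by (simp add: edge_exp_def[of n k] Lambda_form_add_left Lambda_vertex_edge)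
  also have "\<dots> = edge_pairing k l"
    by (cases "even k") (auto simp: vertex_edge_pairing_def edge_pairing_def)
  finally show ?thesis .
qed

lemma Lambda_term_term:
  assumes "even n" "a < b" "b \<le> n + 2" "c < d" "d \<le> n + 2" "k \<in> term_range a b" "l \<in> term_range c d"
  shows "Lambda_form n (term_exp n a b k) (term_exp n c d l) = term_pairing a b k c d l"
proof -
  note bilin = Lambda_form_add_left Lambda_form_add_right Lambda_form_diff_left Lambda_form_diff_right
  note vals = Lambda_vertex_vertex Lambda_vertex_edge Lambda_edge_edge
  have ev: "Lambda_form n (edge_exp n k) (vertex_exp n a) = - vertex_edge_pairing a k" 
    if "1 \<le> a" "1 \<le> k" "a \<le> n + 2" "k \<le> n + 1" for a k
    using that assms(1) Lambda_vertex_edge[of n a k] Lambda_form_skew[of n "vertex_exp n a"] by simp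
  have e0: "edge_exp n 0 = 0" by (simp add: edge_exp_def)
  show ?thesis
  proof (cases "a = 0"; cases "c = 0")
    assume "a = 0" "c = 0"
    then show ?thesis using assms
      by (simp add: term_exp_def term_range_def e0 vals term_pairing_def) (auto simp: pairing_defs)
  next
    assume "a = 0" "c \<noteq> 0"
    then show ?thesis using assms
      by (simp add: term_exp_def term_range_def e0 vals term_pairing_def bilin) (auto simp: pairing_defs)
  next
    assume "a \<noteq> 0" "c = 0"
    then show ?thesis using assms
      by (simp add: term_exp_def term_range_def e0 vals term_pairing_def bilin ev) (auto simp: pairing_defs)
  next
    assume "a \<noteq> 0" "c \<noteq> 0"
    then show ?thesis using assms
      by (simp add: term_exp_def term_range_def e0 vals term_pairing_def bilin ev)
  qed
qed

text \<open>
  A commutation exponent can be read off from one term on each side. The choice of the first terms,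
  \<open>k = a\<close> and \<open>l = c\<close>, gives the right one: along each of the two sums the exponents only change by columns
  of the exchange matrix in one fixed direction, so the product of the first terms occurs once.
\<close>

definition chord_pairing :: "nat \<Rightarrow> nat \<Rightarrow> nat \<Rightarrow> nat \<Rightarrow> int" where
  "chord_pairing a b c d = term_pairing a b a c d c"

context torus_fractions
begin

definition chord_value :: "nat \<Rightarrow> nat \<Rightarrow> 'a" where
  "chord_value a b = \<iota> (chord_torus n a b)"

lemma chord_value_eq: "chord_value a b = (\<Sum>k \<in> term_range a b. torus_monomial (term_exp n a b k))"
  unfolding chord_value_def chord_torus_def torus_monomial_def
  by (rule \<iota>_sum) (simp add: torus_X_in_torus_carrier)

lemma chord_value_mult:
  assumes "a < b" "b \<le> n + 2" "c < d" "d \<le> n + 2"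
  shows "chord_value a b * chord_value c d =
    (\<Sum>k \<in> term_range a b. \<Sum>l \<in> term_range c d.
       \<nu> powi (term_pairing a b k c d l) * torus_monomial (term_exp n a b k + term_exp n c d l))"
  unfolding chord_value_eq sum_product
  using assms n_even by (intro sum.cong refl) (simp add: torus_monomial_mult Lambda_term_term)

lemma unit_powi_times_double_sum:
  "\<nu> powi m * (\<Sum>k \<in> K. \<Sum>l \<in> J. \<nu> powi (p k l) * z k l) =
    (\<Sum>k \<in> K. \<Sum>l \<in> J. \<nu> powi (m + p k l) * z k l)"
  by (simp add: sum_distrib_left unit_powi_times_unit_powi)

end

section \<open>Commutation and Ptolemy relations between increasing vertices\<close>

text \<open>
  Once the order of the indices is known, the pairings are polynomials in the indicators of odd
  parity. The identities between them below hold as polynomial identities, without a case distinction on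
  parities.
\<close>

lemma vertex_pairing_less:
  "x < y \<Longrightarrow> vertex_pairing x y = of_bool (odd y) - of_bool (odd x) * of_bool (odd y)"
  "x < y \<Longrightarrow> vertex_pairing y x = of_bool (odd x) * of_bool (odd y) - of_bool (odd y)"
  "vertex_pairing x x = 0"
  by (auto simp: vertex_pairing_def)

lemma vertex_edge_pairing_le:
  "x \<le> y \<Longrightarrow> vertex_edge_pairing x y = 1 - of_bool (odd x)"
  "y < x \<Longrightarrow> vertex_edge_pairing x y = - of_bool (odd x)"
  by (auto simp: vertex_edge_pairing_def)

lemma edge_pairing_less: "k < l \<Longrightarrow> edge_pairing k l = 1" "l < k \<Longrightarrow> edge_pairing k l = -1" "edge_pairing k k = 0"
  by (simp_all add: edge_pairing_def)

lemmas pairing_values = chord_pairing_def term_pairing_def vertex_pairing_less vertex_edge_pairing_le edge_pairing_less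

lemma term_pairing_disjoint:
  assumes "a < b" "b \<le> c" "c < d" "k \<in> term_range a b" "l \<in> term_range c d"
  shows "term_pairing a b k c d l = 2 * chord_pairing a b c d + term_pairing c d l a b k"
proof -
  have "b = c \<or> b < c" using assms by auto
  then show ?thesis using assms
    by (elim disjE; cases "a = 0"; simp add: pairing_values term_range_def)
qed

text \<open>
  For terms indexed inside the inner chord the exponents match only after the two summation indices have
  been exchanged, since the sign of \<open>l - k\<close> changes. For \<open>a = 0\<close> the outer chord has a single term, and nothing is
  exchanged.
\<close>

lemma term_pairing_nested:
  assumes "a \<le> c" "c < d" "d \<le> b" "k \<in> term_range a b" "l \<in> term_range c d"
  shows "term_pairing a b k c d l = 2 * chord_pairing a b c d +
    (if a \<noteq> 0 \<and> c \<le> k \<and> k < d then term_pairing c d k a b l else term_pairing c d l a b k)"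
proof (cases "a = 0")
  case True
  have "0 = c \<or> 0 < c" "b = d \<or> d < b" using assms by auto
  then show ?thesis using assms True
    by (elim disjE; simp add: pairing_values term_range_def)
next
  case False
  have kl: "a \<le> k" "k < b" "c \<le> l" "l < d"
    using assms False by (auto simp: term_range_def)
  have "k < c \<or> c \<le> k \<and> k < d \<or> d \<le> k" by auto
  moreover have "a = c \<or> a < c" "b = d \<or> d < b" using assms by auto
  ultimately show ?thesis using assms(1-3) kl False
    by (elim disjE; simp add: pairing_values)
qed

lemma term_pairing_straight:
  assumes "a < b" "b < c" "c < d" "k \<in> term_range a b" "l \<in> term_range c d"
  shows "term_pairing a c k b d l = 
      chord_pairing a c a b + chord_pairing a c c d - chord_pairing a b c d + term_pairing a b k c d l"
    and "term_pairing b d l a c k = 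
      chord_pairing b d c d + chord_pairing b d a b - chord_pairing c d a b + term_pairing c d l a b k"
  using assms by (cases "a = 0"; simp add: pairing_values term_range_def)+

text \<open>
  In the product of two crossing chords, the terms with \<open>k < b\<close> and \<open>c \<le> l\<close> belong to the pair of sides
  \<open>ab\<close>, \<open>cd\<close> (the preceding lemma); all others belong to the sides \<open>bc\<close>, \<open>ad\<close>. Which index then serves the
  side \<open>bc\<close> is forced when only one of them lies between \<open>b\<close> and \<open>c\<close>. When both do, either choice gives
  the same monomial, and the power of \<open>\<nu>\<close> selects the order of the factors.
\<close>

lemma term_pairing_crossed:
  assumes "a < b" "b < c" "c < d" "k \<in> term_range a c" "l \<in> term_range b d" "b \<le> k \<or> l < c"
  shows "term_pairing a c k b d l = 
      chord_pairing a c b c + chord_pairing a c a d - chord_pairing b c a d +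
      (if k < b then term_pairing b c l a d k else term_pairing b c k a d l)"
    and "term_pairing b d l a c k = 
      chord_pairing b d b c + chord_pairing b d a d - chord_pairing b c a d +
      (if c \<le> l then term_pairing b c k a d l else term_pairing b c l a d k)"
proof -
  have kl: "a \<le> k" "k < c" "b \<le> l" "l < d"
    using assms by (auto simp: term_range_def split: if_splits)
  have c: "a = 0 \<and> k = 0 \<and> l < c \<or> 0 < a \<and> k < b \<and> l < c \<or> 0 < a \<and> b \<le> k \<and> l < c \<or> 0 < a \<and> b \<le> k \<and> c \<le> l"
    using assms by (auto simp: term_range_def split: if_splits)
  show "term_pairing a c k b d l = 
      chord_pairing a c b c + chord_pairing a c a d - chord_pairing b c a d +
      (if k < b then term_pairing b c l a d k else term_pairing b c k a d l)"
    using c assms(1-3) kl by (elim disjE conjE; simp add: pairing_values)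
  show "term_pairing b d l a c k = 
      chord_pairing b d b c + chord_pairing b d a d - chord_pairing b c a d +
      (if c \<le> l then term_pairing b c k a d l else term_pairing b c l a d k)"
    using c assms(1-3) kl by (elim disjE conjE; simp add: pairing_values)
qed

text \<open>
  The exponent of a product of two terms depends only on the four endpoints and the two edges.
\<close>

lemma term_exp_regroup:
  "term_exp n a b k + term_exp n c d l = term_exp n a b l + term_exp n c d k"
  "term_exp n a c k + term_exp n b d l = term_exp n a b k + term_exp n c d l"
  "term_exp n a c k + term_exp n b d l = term_exp n b c k + term_exp n a d l"
  by (simp_all add: term_exp_def algebra_simps)

context torus_fractions
begin

lemma chord_value_mult_pairs:
  assumes "a < b" "b \<le> n + 2" "c < d" "d \<le> n + 2"
  shows "\<nu> powi m * (chord_value a b * chord_value c d) =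
    (\<Sum>(k, l) \<in> term_range a b \<times> term_range c d.
       \<nu> powi (m + term_pairing a b k c d l) * torus_monomial (term_exp n a b k + term_exp n c d l))"
  unfolding chord_value_mult[OF assms] unit_powi_times_double_sum by (rule sum.cartesian_product)

lemma chord_value_commute_disjoint:
  assumes "a < b" "b \<le> c" "c < d" "d \<le> n + 2"
  shows "q_commute (2 * chord_pairing a b c d) (chord_value a b) (chord_value c d)"
proof -
  let ?f = "\<lambda>k l. \<nu> powi (term_pairing a b k c d l) * torus_monomial (term_exp n a b k + term_exp n c d l)"
  have "chord_value a b * chord_value c d = (\<Sum>l \<in> term_range c d. \<Sum>k \<in> term_range a b. ?f k l)"
    using assms by (simp add: chord_value_mult sum.swap[of _ "term_range c d"])
  also have "\<dots> = \<nu> powi (2 * chord_pairing a b c d) * (chord_value c d * chord_value a b)"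
    using assms term_pairing_disjoint[OF assms(1-3)]
    by (simp add: chord_value_mult unit_powi_times_double_sum add.commute[of "term_exp n c d _"])
  finally show ?thesis by (simp add: q_commute_def)
qed

text \<open>
  Pairs of indices inside the inner chord are matched with the exchanged pair, all others
  with themselves.
\<close>

lemma chord_value_commute_nested:
  assumes "a \<le> c" "c < d" "d \<le> b" "b \<le> n + 2"
  shows "q_commute (2 * chord_pairing a b c d) (chord_value a b) (chord_value c d)"
proof -
  let ?s = "\<lambda>(k, l). if a \<noteq> 0 \<and> c \<le> k \<and> k < d then (k, l) else (l, k)"
  let ?s' = "\<lambda>(l, k). if a \<noteq> 0 \<and> c \<le> k \<and> k < d then (l, k) else (k, l)"
  have "(\<Sum>(k, l) \<in> term_range a b \<times> term_range c d.
       \<nu> powi (0 + term_pairing a b k c d l) * torus_monomial (term_exp n a b k + term_exp n c d l)) =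
     (\<Sum>(l, k) \<in> term_range c d \<times> term_range a b.
       \<nu> powi (2 * chord_pairing a b c d + term_pairing c d l a b k) *
         torus_monomial (term_exp n c d l + term_exp n a b k))"
  proof (rule sum.reindex_bij_witness[where i = ?s' and j = ?s])
    fix p assume p: "p \<in> term_range a b \<times> term_range c d"
    obtain k l where kl: "p = (k, l)" by (cases p)
    show "?s' (?s p) = p" "?s p \<in> term_range c d \<times> term_range a b"
      using p assms by (auto simp: term_range_def split: if_splits)
    have "term_pairing a b k c d l = 2 * chord_pairing a b c d +
      (if a \<noteq> 0 \<and> c \<le> k \<and> k < d then term_pairing c d k a b l else term_pairing c d l a b k)"
      using p kl assms by (intro term_pairing_nested) auto
    then show "(case ?s p of (l, k) \<Rightarrow> \<nu> powi (2 * chord_pairing a b c d + term_pairing c d l a b k) *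
         torus_monomial (term_exp n c d l + term_exp n a b k)) =
      (case p of (k, l) \<Rightarrow> \<nu> powi (0 + term_pairing a b k c d l) * torus_monomial (term_exp n a b k + term_exp n c d l))"
      by (simp add: kl term_exp_regroup(1)[of n a b k] add.commute)
  next
    fix p assume p: "p \<in> term_range c d \<times> term_range a b"
    show "?s (?s' p) = p" "?s' p \<in> term_range a b \<times> term_range c d"
      using p assms by (auto simp: term_range_def split: if_splits)
  qed
  then have "\<nu> powi 0 * (chord_value a b * chord_value c d) =
      \<nu> powi (2 * chord_pairing a b c d) * (chord_value c d * chord_value a b)"
    using assms by (simp only: chord_value_mult_pairs le_trans[of d b "n + 2"] less_le_trans[of c d b]
        le_less_trans[of a c b])
  then show ?thesis by (simp add: q_commute_def)
qed

text \<open>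
  The terms of the left-hand side are distributed over the two products on the right according to
  whether the two indices are separated by the interval from \<open>b\<close> to \<open>c\<close>.
\<close>

lemma ptolemy_increasing:
  assumes "a < b" "b < c" "c < d" "d \<le> n + 2"
  shows "chord_value a c * chord_value b d =
    \<nu> powi (chord_pairing a c a b + chord_pairing a c c d - chord_pairing a b c d) *
      (chord_value a b * chord_value c d) +
    \<nu> powi (chord_pairing a c b c + chord_pairing a c a d - chord_pairing b c a d) *
      (chord_value b c * chord_value a d)" (is "_ = \<nu> powi ?m1 * _ + \<nu> powi ?m2 * _")
proof -
  let ?t = "\<lambda>(k, l). \<nu> powi (term_pairing a c k b d l) * torus_monomial (term_exp n a c k + term_exp n b d l)"
  let ?A = "term_range a c \<times> term_range b d"
  let ?B = "term_range a b \<times> term_range c d"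
  let ?i = "\<lambda>(j, m). if m < b then (m, j) else (j, m)"
  let ?j = "\<lambda>(k, l). if k < b then (l, k) else (k, l)"
  have sub: "?B \<subseteq> ?A" using assms by (auto simp: term_range_def)
  have fin: "finite ?A" by (simp add: term_range_def)
  have "chord_value a c * chord_value b d = sum ?t ?A"
    using chord_value_mult_pairs[of a c b d 0] assms by simp
  also have "\<dots> = sum ?t (?A - ?B) + sum ?t ?B"
    using sum.subset_diff[OF sub fin] by blast
  also have "sum ?t ?B = \<nu> powi ?m1 * (chord_value a b * chord_value c d)"
  proof -
    have "\<nu> powi ?m1 * (chord_value a b * chord_value c d) =
      (\<Sum>(k, l) \<in> ?B. \<nu> powi (?m1 + term_pairing a b k c d l) * torus_monomial (term_exp n a b k + term_exp n c d l))"
      using assms by (intro chord_value_mult_pairs) auto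
    also have "\<dots> = sum ?t ?B"
      using term_pairing_straight(1)[OF assms(1-3)] term_exp_regroup(2)[of n a c _ b d]
      by (intro sum.cong refl) auto
    finally show ?thesis ..
  qed
  also have "sum ?t (?A - ?B) = \<nu> powi ?m2 * (chord_value b c * chord_value a d)"
  proof -
    have "\<nu> powi ?m2 * (chord_value b c * chord_value a d) =
      (\<Sum>(j, m) \<in> term_range b c \<times> term_range a d.
        \<nu> powi (?m2 + term_pairing b c j a d m) * torus_monomial (term_exp n b c j + term_exp n a d m))"
      using assms by (intro chord_value_mult_pairs) auto
    also have "\<dots> = sum ?t (?A - ?B)"
    proof (rule sym, rule sum.reindex_bij_witness[where i = ?i and j = ?j])
      fix p assume p: "p \<in> ?A - ?B"
      obtain k l where kl: "p = (k, l)" by (cases p)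
      have kl': "k \<in> term_range a c" "l \<in> term_range b d" "b \<le> k \<or> l < c"
        using p kl assms by (auto simp: term_range_def split: if_splits)
      show "?i (?j p) = p" "?j p \<in> term_range b c \<times> term_range a d"
        using kl kl' assms by (auto simp: term_range_def split: if_splits)
      show "(case ?j p of (j, m) \<Rightarrow>
          \<nu> powi (?m2 + term_pairing b c j a d m) * torus_monomial (term_exp n b c j + term_exp n a d m)) = ?t p"
        using term_pairing_crossed(1)[OF assms(1-3) kl'] term_exp_regroup(3)[of n a c k b d l]
          term_exp_regroup(1)[of n b c k a d l]
        by (simp add: kl)
    next
      fix p assume p: "p \<in> term_range b c \<times> term_range a d"
      show "?j (?i p) = p" "?i p \<in> ?A - ?B"
        using p assms by (auto simp: term_range_def split: if_splits)
    qed
    finally show ?thesis ..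
  qed
  finally show ?thesis by (simp add: add.commute)
qed

text \<open>
  The same distribution of terms, with the two diagonals multiplied in the other order.
\<close>

lemma ptolemy_rotated:
  assumes "a < b" "b < c" "c < d" "d \<le> n + 2"
  shows "chord_value b d * chord_value a c =
    \<nu> powi (chord_pairing b d b c + chord_pairing b d a d - chord_pairing b c a d) *
      (chord_value b c * chord_value a d) +
    \<nu> powi (chord_pairing b d c d + chord_pairing b d a b - chord_pairing c d a b) *
      (chord_value c d * chord_value a b)" (is "_ = \<nu> powi ?m2 * _ + \<nu> powi ?m1 * _")
proof -
  let ?t = "\<lambda>(l, k). \<nu> powi (term_pairing b d l a c k) * torus_monomial (term_exp n b d l + term_exp n a c k)"
  let ?A = "term_range b d \<times> term_range a c"
  let ?B = "term_range c d \<times> term_range a b"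
  let ?i = "\<lambda>(j, m). if c \<le> m then (m, j) else (j, m)"
  let ?j = "\<lambda>(l, k). if c \<le> l then (k, l) else (l, k)"
  have sub: "?B \<subseteq> ?A" using assms by (auto simp: term_range_def)
  have fin: "finite ?A" by (simp add: term_range_def)
  have "chord_value b d * chord_value a c = sum ?t ?A"
    using chord_value_mult_pairs[of b d a c 0] assms by simp
  also have "\<dots> = sum ?t (?A - ?B) + sum ?t ?B"
    using sum.subset_diff[OF sub fin] by blast
  also have "sum ?t ?B = \<nu> powi ?m1 * (chord_value c d * chord_value a b)"
  proof -
    have "\<nu> powi ?m1 * (chord_value c d * chord_value a b) =
      (\<Sum>(l, k) \<in> ?B. \<nu> powi (?m1 + term_pairing c d l a b k) * torus_monomial (term_exp n c d l + term_exp n a b k))"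
      using assms by (intro chord_value_mult_pairs) auto
    also have "\<dots> = sum ?t ?B"
      using term_pairing_straight(2)[OF assms(1-3)] term_exp_regroup(2)[of n a c _ b d]
      by (intro sum.cong refl) (auto simp: add.commute)
    finally show ?thesis ..
  qed
  also have "sum ?t (?A - ?B) = \<nu> powi ?m2 * (chord_value b c * chord_value a d)"
  proof -
    have "\<nu> powi ?m2 * (chord_value b c * chord_value a d) =
      (\<Sum>(j, m) \<in> term_range b c \<times> term_range a d.
        \<nu> powi (?m2 + term_pairing b c j a d m) * torus_monomial (term_exp n b c j + term_exp n a d m))"
      using assms by (intro chord_value_mult_pairs) auto
    also have "\<dots> = sum ?t (?A - ?B)"
    proof (rule sym, rule sum.reindex_bij_witness[where i = ?i and j = ?j])
      fix p assume p: "p \<in> ?A - ?B"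
      obtain k l where kl: "p = (l, k)" by (cases p)
      have kl': "k \<in> term_range a c" "l \<in> term_range b d" "b \<le> k \<or> l < c"
        using p kl assms by (auto simp: term_range_def split: if_splits)
      show "?i (?j p) = p" "?j p \<in> term_range b c \<times> term_range a d"
        using kl kl' assms by (auto simp: term_range_def split: if_splits)
      show "(case ?j p of (j, m) \<Rightarrow>
          \<nu> powi (?m2 + term_pairing b c j a d m) * torus_monomial (term_exp n b c j + term_exp n a d m)) = ?t p"
        using term_pairing_crossed(2)[OF assms(1-3) kl'] term_exp_regroup(3)[of n a c k b d l]
          term_exp_regroup(1)[of n b c k a d l]
        by (simp add: kl add.commute)
    next
      fix p assume p: "p \<in> term_range b c \<times> term_range a d"
      show "?j (?i p) = p" "?i p \<in> ?A - ?B"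
        using p assms by (auto simp: term_range_def split: if_splits)
    qed
    finally show ?thesis ..
  qed
  finally show ?thesis .
qed

end

section \<open>Cyclic order on the vertices of a polygon\<close>

definition cyclic :: "nat \<Rightarrow> nat \<Rightarrow> nat \<Rightarrow> bool" where
  "cyclic p q r \<longleftrightarrow> p < q \<and> q < r \<or> q < r \<and> r < p \<or> r < p \<and> p < q"

text \<open>
  \<open>p, q, r, s\<close> are distinct and met in this cyclic order.
\<close>

definition quad :: "nat \<Rightarrow> nat \<Rightarrow> nat \<Rightarrow> nat \<Rightarrow> bool" where
  "quad p q r s \<longleftrightarrow> cyclic p q r \<and> cyclic r s p"

definition chord :: "nat \<Rightarrow> nat set \<Rightarrow> bool" where
  "chord n \<alpha> \<longleftrightarrow> (\<exists>a b. \<alpha> = {a, b} \<and> a < b \<and> b \<le> n + 2)"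

definition crossing :: "nat set \<Rightarrow> nat set \<Rightarrow> bool" where
  "crossing \<alpha> \<beta> \<longleftrightarrow> (\<exists>p q r s. \<alpha> = {p, r} \<and> \<beta> = {q, s} \<and> quad p q r s)"

lemma chord_doubleton: "chord n {p, q} \<longleftrightarrow> p \<noteq> q \<and> p \<le> n + 2 \<and> q \<le> n + 2"
  unfolding chord_def doubleton_eq_iff by (cases p q rule: linorder_cases) auto

lemma quad_rotate: "quad p q r s \<Longrightarrow> quad r s p q"
  by (simp add: quad_def)

lemma quad_distinct: "quad p q r s \<Longrightarrow> distinct [p, q, r, s]"
  by (auto simp: quad_def cyclic_def)

lemma quad_rotate1: "quad p q r s \<Longrightarrow> quad q r s p"
  unfolding quad_def cyclic_def by linarith

lemma quad_refine:
  "quad p q r s \<Longrightarrow> quad p b q r \<Longrightarrow> quad p b r s"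
  "quad p q r s \<Longrightarrow> quad q b r p \<Longrightarrow> quad p b r s"
  unfolding quad_def cyclic_def by linarith+

lemma cyclic_two_apexes: "cyclic p q r \<Longrightarrow> cyclic p q' r \<Longrightarrow> q = q' \<or> quad p q q' r \<or> quad p q' q r"
  unfolding quad_def cyclic_def by linarith

text \<open>
  A chord that crosses the diagonal \<open>bd\<close> either starts at \<open>a\<close> or leaves the quadrilateral through one
  of the sides at \<open>a\<close>.
\<close>

lemma crossing_second_diagonal:
  "quad a b c d \<Longrightarrow> quad u b v d \<Longrightarrow> u = a \<or> quad d u a v \<or> quad a u b v"
  unfolding quad_def cyclic_def by linarith

section \<open>Lambda lengths of unordered chords\<close>

definition pairing :: "nat set \<Rightarrow> nat set \<Rightarrow> int" where
  "pairing \<alpha> \<beta> = chord_pairing (Min \<alpha>) (Max \<alpha>) (Min \<beta>) (Max \<beta>)"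

lemma pairing_skew: "pairing \<alpha> \<beta> = - pairing \<beta> \<alpha>"
  by (auto simp: pairing_def chord_pairing_def term_pairing_def vertex_pairing_def edge_pairing_def)

lemma pairing_doubleton:
  "a < b \<Longrightarrow> c < d \<Longrightarrow> pairing {a, b} {c, d} = chord_pairing a b c d"
  by (simp add: pairing_def min_def max_def)

text \<open>
  All terms have coefficient \<open>1\<close>, so no cancellation can occur.
\<close>

lemma chord_torus_keys: "Poly_Mapping.keys (chord_torus n a b) = term_exp n a b ` term_range a b"
proof -
  have "Poly_Mapping.lookup (Poly_Mapping.lookup (chord_torus n a b) u) 0 =
      (\<Sum>k \<in> term_range a b. of_bool (term_exp n a b k = u))" for u
    by (simp add: chord_torus_def lookup_sum torus_X_def lookup_single when_def of_bool_def
        if_distrib[of "\<lambda>x. Poly_Mapping.lookup x 0"] cong: if_cong)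
  also have "\<dots> u = int (card {k \<in> term_range a b. term_exp n a b k = u})" for u
    by (simp add: term_range_def sum_of_bool_eq Int_def)
  finally have l: "Poly_Mapping.lookup (Poly_Mapping.lookup (chord_torus n a b) u) 0 =
      int (card {k \<in> term_range a b. term_exp n a b k = u})" for u .
  show ?thesis
  proof (intro equalityI subsetI)
    fix u assume "u \<in> term_exp n a b ` term_range a b"
    then have "card {k \<in> term_range a b. term_exp n a b k = u} \<noteq> 0"
      by (auto simp: term_range_def)
    then have "Poly_Mapping.lookup (chord_torus n a b) u \<noteq> 0"
      using l[of u] by (metis lookup_zero of_nat_eq_0_iff)
    then show "u \<in> Poly_Mapping.keys (chord_torus n a b)"
      by (simp add: in_keys_iff)
  next
    fix u assume "u \<in> Poly_Mapping.keys (chord_torus n a b)"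
    then have "Poly_Mapping.lookup (chord_torus n a b) u \<noteq> 0"
      by (simp add: in_keys_iff)
    then show "u \<in> term_exp n a b ` term_range a b"
      unfolding chord_torus_def lookup_sum torus_X_def
      by (metis (mono_tags, lifting) image_eqI lookup_single_not_eq sum.neutral)
  qed
qed

lemma chord_torus_nonzero: "a < b \<Longrightarrow> chord_torus n a b \<noteq> 0"
  using chord_torus_keys[of n a b] by (auto simp: term_range_def split: if_splits)

lemma chord_torus_in_carrier [simp]: "chord_torus n a b \<in> torus_carrier n"
  unfolding chord_torus_def by (intro torus_carrier_sum) (simp add: torus_X_in_torus_carrier)

lemma lookup_vertex_exp:
  "Poly_Mapping.lookup (vertex_exp n a) m = of_bool (a \<in> {2..n + 1} \<and> a = m + 1)"
  by (auto simp: vertex_exp_def lookup_single when_def)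

text \<open>
  The vertices cut off by a chord not at \<open>0\<close> are exactly those whose variable occurs in the denominator.
  The index is shifted by one, since the variable of vertex \<open>k\<close> is \<open>X\<^sub>k\<^sub>-\<^sub>1\<close>.
\<close>

lemma chord_torus_denominator:
  assumes "a < b" "b \<le> n + 2"
  shows "{m. \<exists>u \<in> Poly_Mapping.keys (chord_torus n a b). Poly_Mapping.lookup u m < 0} =
    (if a = 0 then {} else {a..<b - 1})"
proof -
  have "(\<exists>k \<in> term_range a b. Poly_Mapping.lookup (term_exp n a b k) m < 0) \<longleftrightarrow>
      a \<noteq> 0 \<and> a \<le> m \<and> m < b - 1" for m
  proof
    assume "\<exists>k \<in> term_range a b. Poly_Mapping.lookup (term_exp n a b k) m < 0"
    then show "a \<noteq> 0 \<and> a \<le> m \<and> m < b - 1"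
      using assms
      by (auto simp: term_exp_def edge_exp_def lookup_add lookup_minus lookup_vertex_exp term_range_def
          of_bool_def split: if_splits)
  next
    assume m: "a \<noteq> 0 \<and> a \<le> m \<and> m < b - 1"
    then have "Poly_Mapping.lookup (term_exp n a b m) m < 0" "m \<in> term_range a b"
      using assms
      by (auto simp: term_exp_def edge_exp_def lookup_add lookup_minus lookup_vertex_exp term_range_def)
    then show "\<exists>k \<in> term_range a b. Poly_Mapping.lookup (term_exp n a b k) m < 0" by blast
  qed
  then show ?thesis by (auto simp: chord_torus_keys)
qed

text \<open>
  The denominator determines both ends of a diagonal not at \<open>0\<close>. The diagonals at \<open>0\<close> are
  monomials without denominator, told apart by their exponent.
\<close>

lemma chord_torus_inject:
  assumes eq: "chord_torus n a b = chord_torus n c d"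
    and "a + 1 < b" "b \<le> n + 2" "c + 1 < d" "d \<le> n + 2" "(a, b) \<noteq> (0, n + 2)" "(c, d) \<noteq> (0, n + 2)"
  shows "a = c \<and> b = d"
proof -
  have den: "(if a = 0 then {} else {a..<b - 1}) = (if c = 0 then {} else {c..<d - 1})"
    using chord_torus_denominator[of a b n] chord_torus_denominator[of c d n] assms by simp
  show ?thesis
  proof (cases "a = 0")
    case True
    then have "c = 0" using den assms by (auto split: if_splits)
    moreover have "b = d"
    proof -
      have "vertex_exp n b = vertex_exp n d"
        using arg_cong[OF eq, of Poly_Mapping.keys] True \<open>c = 0\<close>
        by (simp add: chord_torus_keys term_range_def term_exp_def)
      then have "Poly_Mapping.lookup (vertex_exp n b) (b - 1) = Poly_Mapping.lookup (vertex_exp n d) (b - 1)"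
        by simp
      then show ?thesis
        using True \<open>c = 0\<close> assms by (auto simp: lookup_vertex_exp split: if_splits)
    qed
    ultimately show ?thesis using True by simp
  next
    case False
    then have "c \<noteq> 0" using den assms by (auto split: if_splits)
    with False den have "{a..<b - 1} = {c..<d - 1}" by simp
    moreover have "a < b - 1" "c < d - 1" using assms by auto
    ultimately have "a = c" "b - 1 = d - 1" by (simp_all add: atLeastLessThan_inj)
    then show ?thesis using assms by auto
  qed
qed

context torus_fractions
begin

definition lambda_length :: "nat set \<Rightarrow> 'a" where
  "lambda_length \<alpha> = chord_value (Min \<alpha>) (Max \<alpha>)"

lemma lambda_length_doubleton: "a < b \<Longrightarrow> lambda_length {a, b} = chord_value a b"
  by (simp add: lambda_length_def min_def max_def)

lemma lambda_length_nonzero: "chord n \<alpha> \<Longrightarrow> lambda_length \<alpha> \<noteq> 0"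
  by (auto simp: chord_def lambda_length_doubleton chord_value_def \<iota>_eq_zero_iff chord_torus_nonzero)

text \<open>
  Two chords that do not cross lie side by side or one cuts off the other, in either order.
\<close>

lemma lambda_length_commute:
  assumes "chord n \<alpha>" "chord n \<beta>" "\<not> crossing \<alpha> \<beta>"
  shows "q_commute (2 * pairing \<alpha> \<beta>) (lambda_length \<alpha>) (lambda_length \<beta>)"
proof -
  obtain a b c d where ab: "\<alpha> = {a, b}" "a < b" "b \<le> n + 2" and cd: "\<beta> = {c, d}" "c < d" "d \<le> n + 2"
    using assms by (auto simp: chord_def)
  have "\<not> quad a c b d" "\<not> quad a d b c"
    using assms ab cd unfolding crossing_def by blast+
  then consider "b \<le> c" | "d \<le> a" | "a \<le> c" "d \<le> b" | "c \<le> a" "b \<le> d"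
    using ab cd unfolding quad_def cyclic_def by linarith
  then show ?thesis
  proof cases
    case 1
    then show ?thesis
      using chord_value_commute_disjoint ab cd by (simp add: lambda_length_doubleton pairing_doubleton)
  next
    case 2
    then have "q_commute (2 * pairing \<beta> \<alpha>) (lambda_length \<beta>) (lambda_length \<alpha>)"
      using chord_value_commute_disjoint[of c d a b] ab cd by (simp add: lambda_length_doubleton pairing_doubleton)
    then show ?thesis using q_commute_sym[of _ "lambda_length \<beta>"] pairing_skew[of \<alpha> \<beta>] by fastforce
  next
    case 3
    then show ?thesis
      using chord_value_commute_nested ab cd by (simp add: lambda_length_doubleton pairing_doubleton)
  next
    case 4
    then have "q_commute (2 * pairing \<beta> \<alpha>) (lambda_length \<beta>) (lambda_length \<alpha>)"
      using chord_value_commute_nested[of c a b d] ab cd by (simp add: lambda_length_doubleton pairing_doubleton)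
    then show ?thesis using q_commute_sym[of _ "lambda_length \<beta>"] pairing_skew[of \<alpha> \<beta>] by fastforce
  qed
qed

text \<open>
  With the power of \<open>\<nu>\<close> chosen here, this is \<open>Y\<^sub>\<alpha>\<close> times the normalised cluster monomial with exponent
  \<open>e\<^sub>\<beta> + e\<^sub>\<gamma> - e\<^sub>\<alpha>\<close>, in a cluster containing \<open>\<alpha>\<close>, \<open>\<beta>\<close> and \<open>\<gamma>\<close>.
\<close>

definition exchange_term :: "nat set \<Rightarrow> nat set \<Rightarrow> nat set \<Rightarrow> 'a" where
  "exchange_term \<alpha> \<beta> \<gamma> = \<nu> powi (pairing \<alpha> \<beta> + pairing \<alpha> \<gamma> - pairing \<beta> \<gamma>) * (lambda_length \<beta> * lambda_length \<gamma>)"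

lemma exchange_term_swap:
  assumes "chord n \<beta>" "chord n \<gamma>" "\<not> crossing \<beta> \<gamma>"
  shows "exchange_term \<alpha> \<beta> \<gamma> = exchange_term \<alpha> \<gamma> \<beta>"
proof -
  have "lambda_length \<beta> * lambda_length \<gamma> = \<nu> powi (2 * pairing \<beta> \<gamma>) * (lambda_length \<gamma> * lambda_length \<beta>)"
    using lambda_length_commute[OF assms] by (simp add: q_commute_def)
  then show ?thesis
    using pairing_skew[of \<gamma> \<beta>]
    by (simp add: exchange_term_def unit_powi_times_unit_powi algebra_simps)
qed

text \<open>
  Up to the order of the quasi-commuting factors on the right, the four rotations of a cyclically ordered
  quadruple reduce to the two relations for increasing vertices.
\<close>

lemma quantum_ptolemy:
  assumes "quad p q r s" "{p, q, r, s} \<subseteq> {..n + 2}"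
  shows "lambda_length {p, r} * lambda_length {q, s} =
    exchange_term {p, r} {p, q} {r, s} + exchange_term {p, r} {q, r} {s, p}"
proof -
  have inc: "lambda_length {a, c} * lambda_length {b, d} =
        exchange_term {a, c} {a, b} {c, d} + exchange_term {a, c} {b, c} {a, d}"
    and rot: "lambda_length {b, d} * lambda_length {a, c} =
        exchange_term {b, d} {b, c} {a, d} + exchange_term {b, d} {c, d} {a, b}"
    if "a < b" "b < c" "c < d" "d \<le> n + 2" for a b c d
    using ptolemy_increasing[OF that] ptolemy_rotated[OF that] that
    by (simp_all add: exchange_term_def lambda_length_doubleton pairing_doubleton)
  have sw: "exchange_term \<alpha> {a, b} {c, d} = exchange_term \<alpha> {c, d} {a, b}"
    "exchange_term \<alpha> {b, c} {a, d} = exchange_term \<alpha> {a, d} {b, c}"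
    if "a < b" "b < c" "c < d" "d \<le> n + 2" for \<alpha> a b c d
    using that
    by (auto intro!: exchange_term_swap simp: chord_doubleton crossing_def doubleton_eq_iff quad_def cyclic_def)
  consider "p < q" "q < r" "r < s" | "q < r" "r < s" "s < p" | "r < s" "s < p" "p < q" | "s < p" "p < q" "q < r"
    using assms(1) unfolding quad_def cyclic_def by linarith
  then show ?thesis
  proof cases
    case 1
    then show ?thesis using inc[of p q r s] assms(2) by (simp add: insert_commute)
  next
    case 2
    then show ?thesis using rot[of q r s p] sw[of q r s p] assms(2)
      by (simp add: insert_commute add.commute)
  next
    case 3
    then show ?thesis using inc[of r s p q] sw[of r s p q] assms(2)
      by (simp add: insert_commute add.commute)
  next
    case 4
    then show ?thesis using rot[of s p q r] sw[of s p q r] assms(2)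
      by (simp add: insert_commute add.commute)
  qed
qed

end

section \<open>Triangulations and flips\<close>

definition edges :: "nat \<Rightarrow> nat set set" where
  "edges n = insert {0, n + 2} {{i, i + 1} | i. i \<le> n + 1}"

text \<open>
  The labelling \<open>D\<close> names the diagonals; the sides of the polygon are always present.
\<close>

definition all_chords :: "nat \<Rightarrow> (nat \<Rightarrow> nat set) \<Rightarrow> nat set set" where
  "all_chords n D = D ` {1..n} \<union> edges n"

text \<open>
  That the diagonals cut the polygon into triangles is expressed by \<open>exchange_matrix_of\<close> below, which
  provides two triangles at every diagonal.
\<close>

definition triangulation :: "nat \<Rightarrow> (nat \<Rightarrow> nat set) \<Rightarrow> bool" where
  "triangulation n D \<longleftrightarrow> inj_on D {1..n} \<and> (\<forall>i \<in> {1..n}. chord n (D i) \<and> D i \<notin> edges n) \<and>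
     (\<forall>\<alpha> \<in> all_chords n D. \<forall>\<beta> \<in> all_chords n D. \<not> crossing \<alpha> \<beta>)"

text \<open>
  \<open>p, q, r, s\<close> are the corners of the quadrilateral formed by the two triangles at the diagonal \<open>D k\<close>.
\<close>

definition surrounds :: "nat \<Rightarrow> (nat \<Rightarrow> nat set) \<Rightarrow> nat \<Rightarrow> nat \<Rightarrow> nat \<Rightarrow> nat \<Rightarrow> nat \<Rightarrow> bool" where
  "surrounds n D k p q r s \<longleftrightarrow> quad p q r s \<and> D k = {p, r} \<and>
     {{p, q}, {q, r}, {r, s}, {s, p}} \<subseteq> all_chords n D"

text \<open>
  The entry of the exchange matrix at a row labelled \<open>\<alpha>\<close>, in the column of the diagonal \<open>pr\<close>.
\<close>

definition quad_column :: "nat set \<Rightarrow> nat \<Rightarrow> nat \<Rightarrow> nat \<Rightarrow> nat \<Rightarrow> int" where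
  "quad_column \<alpha> p q r s = of_bool (\<alpha> = {p, q}) + of_bool (\<alpha> = {r, s}) - of_bool (\<alpha> = {q, r}) - of_bool (\<alpha> = {s, p})"

definition column_from_quad :: "nat \<Rightarrow> (nat \<Rightarrow> nat set) \<Rightarrow> (nat \<Rightarrow> nat \<Rightarrow> int) \<Rightarrow> nat \<Rightarrow> bool" where
  "column_from_quad n D B k \<longleftrightarrow>
     (\<exists>p q r s. surrounds n D k p q r s \<and> (\<forall>i \<in> {1..n}. B i k = quad_column (D i) p q r s))"

definition exchange_matrix_of :: "nat \<Rightarrow> (nat \<Rightarrow> nat set) \<Rightarrow> (nat \<Rightarrow> nat \<Rightarrow> int) \<Rightarrow> bool" where
  "exchange_matrix_of n D B \<longleftrightarrow> (\<forall>k \<in> {1..n}. column_from_quad n D B k)"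

lemma edge_chord: "\<alpha> \<in> edges n \<Longrightarrow> chord n \<alpha>"
  by (auto simp: edges_def chord_doubleton)

lemma edges_all_chords: "\<alpha> \<in> edges n \<Longrightarrow> \<alpha> \<in> all_chords n D"
  by (simp add: all_chords_def)

lemma edges_intro: "i \<le> n + 1 \<Longrightarrow> {i, i + 1} \<in> edges n"
  unfolding edges_def by blast

lemma all_chords_chord: "triangulation n D \<Longrightarrow> \<alpha> \<in> all_chords n D \<Longrightarrow> chord n \<alpha>"
  by (auto simp: all_chords_def triangulation_def edge_chord)

lemma crossing_sym: "crossing \<alpha> \<beta> \<Longrightarrow> crossing \<beta> \<alpha>"
  unfolding crossing_def by (metis quad_rotate1 insert_commute)

lemma edge_not_crossing: 
  assumes "\<alpha> \<in> edges n" "chord n \<beta>" shows "\<not> crossing \<alpha> \<beta>"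
proof
  assume "crossing \<alpha> \<beta>"
  then obtain p q r s where c: "\<alpha> = {p, r}" "\<beta> = {q, s}" "quad p q r s"
    by (auto simp: crossing_def)
  then have "p \<le> n + 2" "q \<le> n + 2" "r \<le> n + 2" "s \<le> n + 2"
    using assms edge_chord[OF assms(1)] by (simp_all add: chord_doubleton)
  moreover have "p = 0 \<and> r = n + 2 \<or> p = n + 2 \<and> r = 0 \<or> r = p + 1 \<or> p = r + 1"
    using assms(1) c(1) by (auto simp: edges_def doubleton_eq_iff)
  ultimately show False using c(3) unfolding quad_def cyclic_def by linarith
qed

lemma not_self_crossing: "\<not> crossing \<alpha> \<alpha>"
  by (auto simp: crossing_def doubleton_eq_iff quad_def cyclic_def)

lemma quad_crossing: "quad p q r s \<Longrightarrow> crossing {p, r} {q, s}"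
  by (auto simp: crossing_def)

lemma quad_column_rotate: "quad_column \<alpha> r s p q = quad_column \<alpha> p q r s"
  by (simp add: quad_column_def)

lemma quad_column_rotate1: "quad_column \<alpha> p q r s = - quad_column \<alpha> s p q r"
  by (simp add: quad_column_def insert_commute)

lemma surrounds_rotate: "surrounds n D k p q r s \<Longrightarrow> surrounds n D k r s p q"
  by (auto simp: surrounds_def quad_rotate insert_commute)

lemma quad_column_values:
  assumes "quad p q r s"
  shows "quad_column {p, q} p q r s = 1" "quad_column {r, s} p q r s = 1"
    "quad_column {q, r} p q r s = -1" "quad_column {s, p} p q r s = -1"
  using quad_distinct[OF assms] by (simp_all add: quad_column_def doubleton_eq_iff)

lemma quad_column_eq_zero: 
  "\<alpha> \<notin> {{p, q}, {q, r}, {r, s}, {s, p}} \<Longrightarrow> quad_column \<alpha> p q r s = 0"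
  by (simp add: quad_column_def)

lemma quad_column_parts:
  assumes "quad p q r s"
  shows "max (quad_column \<alpha> p q r s) 0 = of_bool (\<alpha> = {p, q}) + of_bool (\<alpha> = {r, s})"
    and "max (- quad_column \<alpha> p q r s) 0 = of_bool (\<alpha> = {q, r}) + of_bool (\<alpha> = {s, p})"
proof -
  consider "\<alpha> = {p, q}" | "\<alpha> = {q, r}" | "\<alpha> = {r, s}" | "\<alpha> = {s, p}"
    | "\<alpha> \<notin> {{p, q}, {q, r}, {r, s}, {s, p}}" by blast
  note cases = this
  show "max (quad_column \<alpha> p q r s) 0 = of_bool (\<alpha> = {p, q}) + of_bool (\<alpha> = {r, s})"
    using quad_distinct[OF assms] by (cases rule: cases) (simp_all add: quad_column_def doubleton_eq_iff)
  show "max (- quad_column \<alpha> p q r s) 0 = of_bool (\<alpha> = {q, r}) + of_bool (\<alpha> = {s, p})"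
    using quad_distinct[OF assms] by (cases rule: cases) (simp_all add: quad_column_def doubleton_eq_iff)
qed

text \<open>
  Two triangles on the same side of a common chord would have crossing sides.
\<close>

lemma apex_unique:
  assumes "triangulation n D" "cyclic p q r" "cyclic p q' r"
    "{{p, q}, {q, r}, {p, q'}, {q', r}} \<subseteq> all_chords n D"
  shows "q = q'"
proof (rule ccontr)
  assume "q \<noteq> q'"
  then have "crossing {p, q'} {q, r} \<or> crossing {p, q} {q', r}"
    using cyclic_two_apexes[OF assms(2,3)] quad_crossing by blast
  then show False
    using assms(1,4) unfolding triangulation_def by blast
qed

lemma surrounds_unique:
  assumes "triangulation n D" "surrounds n D k p q r s" "surrounds n D k p' q' r' s'"
  shows "(p', q', r', s') = (p, q, r, s) \<or> (p', q', r', s') = (r, s, p, q)"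
proof -
  have *: "q' = q \<and> s' = s" if "surrounds n D k p q r s" "surrounds n D k p q' r s'" for p q r s q' s'
    using that apex_unique[OF assms(1), of p q r q'] apex_unique[OF assms(1), of r s p s']
    by (auto simp: surrounds_def quad_def insert_commute)
  have "p' = p \<and> r' = r \<or> p' = r \<and> r' = p"
    using assms(2,3) by (auto simp: surrounds_def doubleton_eq_iff)
  then show ?thesis
    using *[of p q r s q' s'] *[of r s p q q' s'] surrounds_rotate assms(2,3) by blast
qed

locale flip =
  fixes n :: nat and D :: "nat \<Rightarrow> nat set" and k a b c d :: nat
  assumes tri: "triangulation n D" and k: "k \<in> {1..n}" and sur: "surrounds n D k a b c d"
begin

definition flipped :: "nat \<Rightarrow> nat set" where "flipped = D(k := {b, d})"

lemma quad: "quad a b c d" and Dk: "D k = {a, c}" and sides: "{{a, b}, {b, c}, {c, d}, {d, a}} \<subseteq> all_chords n D"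
  using sur by (auto simp: surrounds_def)

lemma flipped_k: "flipped k = {b, d}" and flipped_other: "i \<noteq> k \<Longrightarrow> flipped i = D i"
  by (simp_all add: flipped_def)

lemma Dk_chord: "{a, c} \<in> all_chords n D"
  using k Dk by (auto simp: all_chords_def)

lemma noncrossing: "\<alpha> \<in> all_chords n D \<Longrightarrow> \<beta> \<in> all_chords n D \<Longrightarrow> \<not> crossing \<alpha> \<beta>"
  using tri by (auto simp: triangulation_def)

lemma new_not_old: "{b, d} \<notin> all_chords n D"
  using noncrossing[OF Dk_chord] quad_crossing[OF quad] by blast

text \<open>
  A chord that crosses the new diagonal cannot leave the quadrilateral through one of its sides, so it
  runs from corner to corner.
\<close>

lemma only_crossed:
  assumes "\<alpha> \<in> all_chords n D" "crossing \<alpha> {b, d}"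
  shows "\<alpha> = {a, c}"
proof -
  obtain u v where uv: "\<alpha> = {u, v}" "quad u b v d"
  proof -
    obtain p q r s where c: "\<alpha> = {p, r}" "{b, d} = {q, s}" "quad p q r s"
      using assms(2) unfolding crossing_def by blast
    then have "q = b \<and> s = d \<or> q = d \<and> s = b" by (auto simp: doubleton_eq_iff)
    then show ?thesis using that[of p r] that[of r p] c quad_rotate by (auto simp: insert_commute)
  qed
  have nc: "\<not> quad p q r s" if "{p, r} = \<alpha>" "{q, s} \<in> all_chords n D" for p q r s
    using noncrossing[OF assms(1) that(2)] that(1) quad_crossing[of p q r s] by auto
  have "u = a"
    using crossing_second_diagonal[OF quad uv(2)] nc[of u v a d] nc[of u v b a] quad_rotate1 sides uv(1)
    by (metis insert_commute insert_subset)
  moreover have "v = c"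
    using crossing_second_diagonal[OF quad_rotate[OF quad] quad_rotate[OF uv(2)]]
      nc[of v u c b] nc[of v u d c] quad_rotate1 sides uv(1)
    by (metis insert_commute insert_subset)
  ultimately show ?thesis using uv by simp
qed

lemma D_eq_iff: "i \<in> {1..n} \<Longrightarrow> D i = {a, c} \<longleftrightarrow> i = k"
  using tri k unfolding Dk[symmetric] triangulation_def inj_on_def by blast

lemma all_chords_new:
  assumes "\<alpha> \<in> all_chords n flipped"
  shows "\<alpha> = {b, d} \<or> \<alpha> \<in> all_chords n D \<and> \<alpha> \<noteq> {a, c}"
proof (cases "\<alpha> \<in> edges n")
  case True
  have "{a, c} \<notin> edges n"
    using tri k unfolding Dk[symmetric] triangulation_def by blast
  with True show ?thesis by (auto simp: all_chords_def)
next
  case False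
  then obtain i where "i \<in> {1..n}" "\<alpha> = flipped i"
    using assms by (auto simp: all_chords_def)
  then show ?thesis
    using D_eq_iff[of i] by (cases "i = k") (auto simp: flipped_k flipped_other all_chords_def)
qed

lemma new_in_all_chords: "{b, d} \<in> all_chords n flipped"
  using k flipped_k by (auto simp: all_chords_def)

lemma old_in_all_chords: "\<alpha> \<in> all_chords n D \<Longrightarrow> \<alpha> \<noteq> {a, c} \<Longrightarrow> \<alpha> \<in> all_chords n flipped"
  using Dk unfolding all_chords_def by (auto simp: flipped_def image_iff)

lemma subset_new: "S \<subseteq> all_chords n D \<Longrightarrow> {a, c} \<notin> S \<Longrightarrow> S \<subseteq> all_chords n flipped"
  using old_in_all_chords by blast

lemma new_chord: "chord n {b, d}"
  using sides all_chords_chord[OF tri, of "{a, b}"] all_chords_chord[OF tri, of "{d, a}"]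
    quad_distinct[OF quad] by (simp add: chord_doubleton)

lemma triangulation_flip: "triangulation n flipped"
  unfolding triangulation_def
proof (intro conjI ballI)
  show "inj_on flipped {1..n}"
  proof (rule inj_onI)
    fix i j assume ij: "i \<in> {1..n}" "j \<in> {1..n}" "flipped i = flipped j"
    have "D i \<noteq> {b, d}" if "i \<in> {1..n}" for i
      using new_not_old that by (auto simp: all_chords_def)
    then show "i = j"
      using ij tri by (auto simp: flipped_def triangulation_def inj_on_eq_iff split: if_splits)
  qed
next
  fix i assume "i \<in> {1..n}"
  then show "chord n (flipped i)"
    using tri new_chord by (auto simp: flipped_def triangulation_def)
  show "flipped i \<notin> edges n"
    using tri \<open>i \<in> {1..n}\<close> new_not_old by (auto simp: flipped_def triangulation_def all_chords_def)
next
  fix \<alpha> \<beta> assume "\<alpha> \<in> all_chords n flipped" "\<beta> \<in> all_chords n flipped"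
  then show "\<not> crossing \<alpha> \<beta>"
    using all_chords_new only_crossed crossing_sym not_self_crossing noncrossing by metis
qed

lemma sides_new: "{{a, b}, {b, c}, {c, d}, {d, a}} \<subseteq> all_chords n flipped"
  using quad_distinct[OF quad] by (intro subset_new[OF sides]) (simp add: doubleton_eq_iff)

lemma surrounds_flip: "surrounds n flipped k b c d a"
  using quad_rotate1[OF quad] sides_new flipped_k by (auto simp: surrounds_def)

lemma column_from_quad_flip_self:
  assumes B: "\<forall>i \<in> {1..n}. B i k = quad_column (D i) a b c d"
  shows "column_from_quad n flipped (mutate_B k B) k"
  unfolding column_from_quad_def
proof (intro exI conjI ballI)
  show "surrounds n flipped k b c d a" by (rule surrounds_flip)
  fix i assume i: "i \<in> {1..n}"
  have "quad_column {a, c} a b c d = 0" "quad_column {b, d} b c d a = 0"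
    using quad_distinct[OF quad] by (simp_all add: quad_column_def doubleton_eq_iff)
  then show "mutate_B k B i k = quad_column (flipped i) b c d a"
    using B i Dk flipped_k quad_column_rotate1[of "D i" b c d a]
    by (cases "i = k") (simp_all add: mutate_B_def flipped_other)
qed

text \<open>
  Here the mutation rule adds nothing, because the entry \<open>B k j\<close> vanishes.
\<close>

lemma column_from_quad_flip_far:
  assumes B: "\<forall>i \<in> {1..n}. B i k = quad_column (D i) a b c d"
    and j: "j \<in> {1..n}" "j \<noteq> k" "surrounds n D j p q r s" "\<forall>i \<in> {1..n}. B i j = quad_column (D i) p q r s"
    and far: "{a, c} \<notin> {{p, q}, {q, r}, {r, s}, {s, p}}"
  shows "column_from_quad n flipped (mutate_B k B) j"
  unfolding column_from_quad_def
proof (intro exI conjI ballI)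
  show "surrounds n flipped j p q r s"
    using j(2,3) subset_new[OF _ far] unfolding surrounds_def flipped_other[OF j(2)] by blast
  fix i assume i: "i \<in> {1..n}"
  have "B k j = 0" using j(4) k quad_column_eq_zero[OF far] Dk by simp
  moreover have "quad_column {b, d} p q r s = 0"
    using new_not_old j(3) by (intro quad_column_eq_zero) (auto simp: surrounds_def)
  ultimately show "mutate_B k B i j = quad_column (flipped i) p q r s"
    using i j by (cases "i = k") (auto simp: mutate_B_def flipped_k flipped_other)
qed

text \<open>
  In the cases of interest \<open>B k j\<close> is \<open>1\<close> or \<open>-1\<close>, and the mutation rule adds a positive or a
  negative part.
\<close>

lemma half_abs:
  fixes x :: int
  shows "(\<bar>x\<bar> * 1 + x * \<bar>1\<bar>) div 2 = max x 0" "(\<bar>x\<bar> * (-1) + x * \<bar>-1\<bar>) div 2 = - max (- x) 0"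
  by auto

lemma D_neq_new: "i \<in> {1..n} \<Longrightarrow> D i \<noteq> {b, d}"
  using new_not_old by (auto simp: all_chords_def)

text \<open>
  The old diagonal \<open>ac\<close> is the side \<open>pq\<close> around \<open>D j\<close>, so that \<open>r = d\<close> by uniqueness of the third corner.
  After the flip the corner \<open>q\<close> is replaced by \<open>b\<close>, and the mutation rule adds the positive part of column \<open>k\<close>.
\<close>

lemma column_from_quad_flip_near:
  assumes B: "\<forall>i \<in> {1..n}. B i k = quad_column (D i) a b c d"
    and j: "j \<in> {1..n}" "j \<noteq> k" "surrounds n D j p q r s" "\<forall>i \<in> {1..n}. B i j = quad_column (D i) p q r s"
    and near: "a = p" "c = q"
  shows "column_from_quad n flipped (mutate_B k B) j"
proof -
  have q: "quad p q r s" and Dj: "D j = {p, r}" and sj: "{{p, q}, {q, r}, {r, s}, {s, p}} \<subseteq> all_chords n D"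
    using j(3) by (auto simp: surrounds_def)
  have pr: "{p, r} \<in> all_chords n D" using Dj j(1) by (auto simp: all_chords_def)
  have "cyclic c r a" "cyclic c d a"
    using q quad near unfolding quad_def cyclic_def by auto
  then have rd: "r = d"
    using apex_unique[OF tri, of c r a d] sj sides near pr by (auto simp: insert_commute)
  have new: "quad p b r s"
    using quad_refine(1)[OF q] quad near rd by simp
  have dist: "distinct [p, q, r, s]" "distinct [p, b, r, s]" "distinct [a, b, c, d]"
    using q new quad by (auto dest: quad_distinct)
  have rs: "{{r, s}, {s, p}} \<subseteq> all_chords n flipped"
    using sj dist near by (intro subset_new) (simp_all add: doubleton_eq_iff)
  show ?thesis
    unfolding column_from_quad_def
  proof (intro exI conjI ballI)
    show "surrounds n flipped j p b r s"
      using new Dj sides_new new_in_all_chords rs near rd j(2)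
      by (simp add: surrounds_def flipped_other insert_commute)
    fix i assume i: "i \<in> {1..n}"
    have Bkj: "B k j = 1" using j(4) k Dk near quad_column_values[OF q] by simp
    show "mutate_B k B i j = quad_column (flipped i) p b r s"
    proof (cases "i = k")
      case True
      then show ?thesis
        using Bkj j(2) quad_column_values(3)[OF new] rd by (simp add: mutate_B_def flipped_k)
    next
      case False
      then have "mutate_B k B i j = quad_column (D i) p q r s + max (quad_column (D i) a b c d) 0"
        using i j B Bkj half_abs(1)[of "B i k"] by (simp add: mutate_B_def)
      then have "mutate_B k B i j = quad_column (D i) p q r s +
          (of_bool (D i = {a, b}) + of_bool (D i = {c, d}))"
        by (simp only: quad_column_parts(1)[OF quad])
      then show ?thesis
        using D_eq_iff[OF i] D_neq_new[OF i] False near rd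
        by (simp add: quad_column_def flipped_other insert_commute)
    qed
  qed
qed

text \<open>
  The old diagonal \<open>ac\<close> is the side \<open>qr\<close> around \<open>D j\<close>, so that \<open>p = d\<close>. Again \<open>b\<close> replaces \<open>q\<close>, and now the
  negative part of column \<open>k\<close> is subtracted.
\<close>

lemma column_from_quad_flip_near':
  assumes B: "\<forall>i \<in> {1..n}. B i k = quad_column (D i) a b c d"
    and j: "j \<in> {1..n}" "j \<noteq> k" "surrounds n D j p q r s" "\<forall>i \<in> {1..n}. B i j = quad_column (D i) p q r s"
    and near: "a = q" "c = r"
  shows "column_from_quad n flipped (mutate_B k B) j"
proof -
  have q: "quad p q r s" and Dj: "D j = {p, r}" and sj: "{{p, q}, {q, r}, {r, s}, {s, p}} \<subseteq> all_chords n D"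
    using j(3) by (auto simp: surrounds_def)
  have pr: "{p, r} \<in> all_chords n D" using Dj j(1) by (auto simp: all_chords_def)
  have "cyclic c p a" "cyclic c d a"
    using q quad near unfolding quad_def cyclic_def by auto
  then have pd: "p = d"
    using apex_unique[OF tri, of c p a d] sj sides near pr by (auto simp: insert_commute)
  have new: "quad p b r s"
    using quad_refine(2)[OF q] quad near pd by simp
  have dist: "distinct [p, q, r, s]" "distinct [p, b, r, s]" "distinct [a, b, c, d]"
    using q new quad by (auto dest: quad_distinct)
  have rs: "{{r, s}, {s, p}} \<subseteq> all_chords n flipped"
    using sj dist near by (intro subset_new) (simp_all add: doubleton_eq_iff)
  show ?thesis
    unfolding column_from_quad_def
  proof (intro exI conjI ballI)
    show "surrounds n flipped j p b r s"
      using new Dj sides_new new_in_all_chords rs near pd j(2)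
      by (simp add: surrounds_def flipped_other insert_commute)
    fix i assume i: "i \<in> {1..n}"
    have Bkj: "B k j = -1" using j(4) k Dk near quad_column_values[OF q] by simp
    show "mutate_B k B i j = quad_column (flipped i) p b r s"
    proof (cases "i = k")
      case True
      then show ?thesis
        using Bkj j(2) quad_column_values(1)[OF new] pd by (simp add: mutate_B_def flipped_k insert_commute)
    next
      case False
      then have "mutate_B k B i j = quad_column (D i) p q r s - max (- quad_column (D i) a b c d) 0"
        using i j B Bkj half_abs(2)[of "B i k"] by (simp add: mutate_B_def)
      then have "mutate_B k B i j = quad_column (D i) p q r s -
          (of_bool (D i = {b, c}) + of_bool (D i = {d, a}))"
        by (simp only: quad_column_parts(2)[OF quad])
      then show ?thesis
        using D_eq_iff[OF i] D_neq_new[OF i] False near pd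
        by (simp add: quad_column_def flipped_other insert_commute)
    qed
  qed
qed

end

lemma flip_rotate: "flip n D k a b c d \<Longrightarrow> flip n D k c d a b"
  by (auto simp: flip_def surrounds_rotate)

text \<open>
  Besides column \<open>k\<close>, which changes its sign, only those columns change that belong to a diagonal with
  \<open>D k\<close> among its four surrounding sides. Rotating either of the two quadrilaterals by half a turn changes
  nothing, which leaves the two positions of \<open>D k\<close> treated above.
\<close>

lemma (in flip) exchange_matrix_flip:
  assumes "exchange_matrix_of n D B"
  shows "exchange_matrix_of n flipped (mutate_B k B)"
proof -
  have B: "\<forall>i \<in> {1..n}. B i k = quad_column (D i) a b c d"
  proof -
    obtain p q r s where "surrounds n D k p q r s" "\<forall>i \<in> {1..n}. B i k = quad_column (D i) p q r s"
      using assms k unfolding exchange_matrix_of_def column_from_quad_def by blast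
    then show ?thesis
      using surrounds_unique[OF tri sur] quad_column_rotate by fastforce
  qed
  have B2: "\<forall>i \<in> {1..n}. B i k = quad_column (D i) c d a b"
    using B quad_column_rotate by metis
  interpret rot: flip n D k c d a b
    by (rule flip_rotate) unfold_locales
  have rotD': "rot.flipped = flipped" by (simp add: flipped_def rot.flipped_def insert_commute)
  show ?thesis
    unfolding exchange_matrix_of_def
  proof
    fix j assume j: "j \<in> {1..n}"
    show "column_from_quad n flipped (mutate_B k B) j"
    proof (cases "j = k")
      case True
      then show ?thesis using column_from_quad_flip_self[of B] B by simp
    next
      case False
      obtain p q r s where 1: "surrounds n D j p q r s" "\<forall>i \<in> {1..n}. B i j = quad_column (D i) p q r s"
        using assms j unfolding exchange_matrix_of_def column_from_quad_def by blast
      then have 2: "surrounds n D j r s p q" "\<forall>i \<in> {1..n}. B i j = quad_column (D i) r s p q"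
        by (simp_all add: surrounds_rotate quad_column_rotate)
      have side: "column_from_quad n flipped (mutate_B k B) j"
        if "{a, c} = {p, q} \<or> {a, c} = {q, r}"
          and "surrounds n D j p q r s" "\<forall>i \<in> {1..n}. B i j = quad_column (D i) p q r s" for p q r s
      proof -
        have "a = p \<and> c = q \<or> c = p \<and> a = q \<or> a = q \<and> c = r \<or> c = q \<and> a = r"
          using that(1) by (auto simp: doubleton_eq_iff)
        then show ?thesis
          using column_from_quad_flip_near[OF B j False that(2,3)] column_from_quad_flip_near'[OF B j False that(2,3)]
            rot.column_from_quad_flip_near[OF B2 j False that(2,3)] rot.column_from_quad_flip_near'[OF B2 j False that(2,3)]
          unfolding rotD' by blast
      qed
      consider "{a, c} = {p, q} \<or> {a, c} = {q, r}" | "{a, c} = {r, s} \<or> {a, c} = {s, p}"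
        | "{a, c} \<notin> {{p, q}, {q, r}, {r, s}, {s, p}}"
        by auto
      then show ?thesis
        using side[OF _ 1] side[OF _ 2] column_from_quad_flip_far[OF B j False 1] by cases
    qed
  qed
qed

section \<open>Quantum seeds are triangulations\<close>

lemma edge_cases:
  assumes "\<alpha> \<in> edges n"
  obtains i where "i \<le> n + 1" "\<alpha> = {i, i + 1}" | "\<alpha> = {0, n + 2}"
  using assms by (auto simp: edges_def)

text \<open>
  A side has the single term \<open>1\<close>.
\<close>

lemma edge_term_exp:
  assumes "\<alpha> \<in> edges n"
  shows "term_range (Min \<alpha>) (Max \<alpha>) = {Min \<alpha>}" "term_exp n (Min \<alpha>) (Max \<alpha>) (Min \<alpha>) = 0"
  using assms by (cases rule: edge_cases; simp add: term_range_def term_exp_def edge_exp_def min_def max_def)+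

context torus_fractions
begin

lemma lambda_length_edge: "\<alpha> \<in> edges n \<Longrightarrow> lambda_length \<alpha> = 1"
  using edge_term_exp by (simp add: lambda_length_def chord_value_eq torus_monomial_zero)

lemma pairing_edge:
  assumes "\<alpha> \<in> edges n" "chord n \<beta>"
  shows "pairing \<alpha> \<beta> = 0" "pairing \<beta> \<alpha> = 0"
proof -
  have mm: "Min \<gamma> < Max \<gamma> \<and> Max \<gamma> \<le> n + 2" if "chord n \<gamma>" for \<gamma>
    using that by (auto simp: chord_def min_def max_def)
  have "pairing \<alpha> \<beta> = Lambda_form n (term_exp n (Min \<alpha>) (Max \<alpha>) (Min \<alpha>)) (term_exp n (Min \<beta>) (Max \<beta>) (Min \<beta>))"
    unfolding pairing_def chord_pairing_def
    using mm[OF edge_chord[OF assms(1)]] mm[OF assms(2)] n_even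
    by (intro Lambda_term_term[symmetric]) (auto simp: term_range_def)
  then show "pairing \<alpha> \<beta> = 0" using edge_term_exp(2)[OF assms(1)] by simp
  then show "pairing \<beta> \<alpha> = 0" using pairing_skew[of \<beta> \<alpha>] by simp
qed

definition triangulation_seed ::
  "(nat \<Rightarrow> nat set) \<Rightarrow> (nat \<Rightarrow> nat \<Rightarrow> int) \<Rightarrow> (nat \<Rightarrow> nat \<Rightarrow> int) \<Rightarrow> (nat \<Rightarrow> 'a) \<Rightarrow> bool" where
  "triangulation_seed D B L Y \<longleftrightarrow> triangulation n D \<and> exchange_matrix_of n D B \<and>
     (\<forall>i \<in> {1..n}. Y i = lambda_length (D i)) \<and>
     (\<forall>i \<in> {1..n}. \<forall>j \<in> {1..n}. L i j = pairing (D i) (D j))"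

text \<open>
  The exponent vector of the chord \<open>\<alpha>\<close>, which is zero when \<open>\<alpha>\<close> is a side. Thus sides need no
  separate treatment in exchange relations.
\<close>

definition chord_indicator :: "(nat \<Rightarrow> nat set) \<Rightarrow> nat set \<Rightarrow> nat \<Rightarrow> int" where
  "chord_indicator D \<alpha> i = of_bool (D i = \<alpha>)"

context
  fixes D B L Y
  assumes seed: "triangulation_seed D B L Y"
begin

lemma seed_tri: "triangulation n D" and seed_exch: "exchange_matrix_of n D B"
  and seed_Y: "i \<in> {1..n} \<Longrightarrow> Y i = lambda_length (D i)"
  and seed_L: "i \<in> {1..n} \<Longrightarrow> j \<in> {1..n} \<Longrightarrow> L i j = pairing (D i) (D j)"
  and seed_chord: "i \<in> {1..n} \<Longrightarrow> chord n (D i)"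
  using seed by (auto simp: triangulation_seed_def triangulation_def)

abbreviation seed_monomial :: "(nat \<Rightarrow> int) \<Rightarrow> 'a" where
  "seed_monomial \<equiv> cluster_monomial n \<nu> L Y"

lemma seed_monomial_mult:
  "seed_monomial u * seed_monomial v = \<nu> powi (\<Sum>i = 1..n. \<Sum>j = 1..n. L i j * u i * v j) * seed_monomial (\<lambda>i. u i + v i)"
proof (rule cluster_monomial_mult)
  fix i j assume ij: "i \<in> {1..n}" "j \<in> {1..n}"
  have "\<not> crossing (D i) (D j)"
    using seed_tri ij by (auto simp: triangulation_def all_chords_def)
  then show "q_commute (2 * L i j) (Y i) (Y j)"
    using ij seed_Y seed_L seed_chord lambda_length_commute by simp
  show "L j i = - L i j"
    using ij seed_L pairing_skew[of "D j"] by simp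
next
  fix i assume "i \<in> {1..n}"
  then show "Y i \<noteq> 0" using seed_Y seed_chord lambda_length_nonzero by simp
qed

lemma indic_edge: "\<alpha> \<in> edges n \<Longrightarrow> i \<in> {1..n} \<Longrightarrow> chord_indicator D \<alpha> i = 0"
  using seed_tri by (auto simp: chord_indicator_def triangulation_def)

lemma indic_diagonal: "i \<in> {1..n} \<Longrightarrow> k \<in> {1..n} \<Longrightarrow> chord_indicator D (D k) i = (if i = k then 1 else 0)"
  using seed_tri by (auto simp: chord_indicator_def triangulation_def inj_on_eq_iff)

lemma all_chords_cases:
  assumes "\<alpha> \<in> all_chords n D"
  obtains "\<alpha> \<in> edges n" | k where "k \<in> {1..n}" "\<alpha> = D k"
  using assms by (auto simp: all_chords_def)

lemma seed_monomial_indic: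
  assumes "\<alpha> \<in> all_chords n D"
  shows "seed_monomial (chord_indicator D \<alpha>) = lambda_length \<alpha>"
  using assms
proof (cases rule: all_chords_cases)
  case 1
  then have "seed_monomial (chord_indicator D \<alpha>) = seed_monomial (\<lambda>_. 0)"
    by (intro cluster_monomial_cong) (rule indic_edge)
  then show ?thesis by (simp add: cluster_monomial_zero lambda_length_edge 1)
next
  case (2 k)
  then have "seed_monomial (chord_indicator D \<alpha>) = seed_monomial (\<lambda>i. if i = k then 1 else 0)"
    by (intro cluster_monomial_cong) (simp add: indic_diagonal)
  then show ?thesis using cluster_monomial_unit[OF 2(1)] seed_Y[OF 2(1)] 2(2) by simp
qed

lemma seed_form_indic:
  assumes "\<alpha> \<in> all_chords n D" "\<beta> \<in> all_chords n D"
  shows "(\<Sum>i = 1..n. \<Sum>j = 1..n. L i j * chord_indicator D \<alpha> i * chord_indicator D \<beta> j) = pairing \<alpha> \<beta>"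
proof (cases "\<alpha> \<in> edges n \<or> \<beta> \<in> edges n")
  case True
  then have "(\<Sum>i = 1..n. \<Sum>j = 1..n. L i j * chord_indicator D \<alpha> i * chord_indicator D \<beta> j) = 0"
    by (intro sum.neutral ballI) (auto simp: indic_edge)
  then show ?thesis
    using True pairing_edge all_chords_chord[OF seed_tri] assms by metis
next
  case False
  then obtain k l where kl: "k \<in> {1..n}" "l \<in> {1..n}" "\<alpha> = D k" "\<beta> = D l"
    using assms by (auto simp: all_chords_def)
  have "(\<Sum>i = 1..n. \<Sum>j = 1..n. L i j * chord_indicator D \<alpha> i * chord_indicator D \<beta> j) =
      (\<Sum>i = 1..n. \<Sum>j = 1..n. if j = l then (if i = k then L i j else 0) else 0)"
    using kl by (intro sum.cong refl) (simp add: indic_diagonal)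
  also have "\<dots> = L k l" using kl by simp
  finally show ?thesis using kl seed_L by simp
qed

text \<open>
  Multiplicativity of normalised monomials gives both sides as multiples of the monomial
  with exponent \<open>e\<^sub>\<alpha> + e\<^sub>\<beta>\<close>.
\<close>

lemma seed_exchange_term:
  assumes "k \<in> {1..n}" "\<alpha> \<in> all_chords n D" "\<beta> \<in> all_chords n D"
  shows "lambda_length (D k) * seed_monomial (\<lambda>i. chord_indicator D \<alpha> i + chord_indicator D \<beta> i - (if i = k then 1 else 0)) =
    exchange_term (D k) \<alpha> \<beta>"
proof -
  let ?u = "chord_indicator D (D k)" and ?w = "\<lambda>i. chord_indicator D \<alpha> i + chord_indicator D \<beta> i - (if i = k then 1 else 0)"
  let ?F = "\<lambda>u v. (\<Sum>i = 1..n. \<Sum>j = 1..n. L i j * u i * v j)"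
  have k: "D k \<in> all_chords n D" using assms by (auto simp: all_chords_def)
  have "lambda_length (D k) * seed_monomial ?w = seed_monomial ?u * seed_monomial ?w" by (simp add: seed_monomial_indic[OF k])
  also have "\<dots> = \<nu> powi (?F ?u ?w) * seed_monomial (\<lambda>i. ?u i + ?w i)" by (rule seed_monomial_mult)
  also have "seed_monomial (\<lambda>i. ?u i + ?w i) = seed_monomial (\<lambda>i. chord_indicator D \<alpha> i + chord_indicator D \<beta> i)"
    using assms by (intro cluster_monomial_cong) (simp add: indic_diagonal)
  also have "?F ?u ?w = ?F ?u (\<lambda>j. chord_indicator D \<alpha> j + chord_indicator D \<beta> j - ?u j)"
    using assms by (intro sum.cong refl) (simp add: indic_diagonal)
  also have "\<dots> = ?F ?u (chord_indicator D \<alpha>) + ?F ?u (chord_indicator D \<beta>) - ?F ?u ?u"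
    by (simp add: algebra_simps sum.distrib sum_subtractf)
  also have "\<dots> = pairing (D k) \<alpha> + pairing (D k) \<beta>"
    unfolding seed_form_indic[OF k assms(2)] seed_form_indic[OF k assms(3)] seed_form_indic[OF k k]
    using pairing_skew[of "D k" "D k"] by simp
  finally have 1: "lambda_length (D k) * seed_monomial ?w =
      \<nu> powi (pairing (D k) \<alpha> + pairing (D k) \<beta>) * seed_monomial (\<lambda>i. chord_indicator D \<alpha> i + chord_indicator D \<beta> i)" .
  have "lambda_length \<alpha> * lambda_length \<beta> = \<nu> powi (pairing \<alpha> \<beta>) * seed_monomial (\<lambda>i. chord_indicator D \<alpha> i + chord_indicator D \<beta> i)"
    using seed_monomial_mult[of "chord_indicator D \<alpha>" "chord_indicator D \<beta>"] assms
    by (simp add: seed_monomial_indic seed_form_indic del: One_nat_def)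
  then show ?thesis
    by (simp add: 1 exchange_term_def unit_powi_times_unit_powi)
qed

text \<open>
  After multiplication by the old variable from the left, the exchange relation becomes the quantum Ptolemy
  relation, from which the old variable can be cancelled. The commutation exponents of the new cluster are
  those of the new triangulation because its diagonals do not cross.
\<close>

lemma seed_flip:
  assumes k: "k \<in> {1..n}" and sur: "surrounds n D k a b c d"
    and Y': "Y' = mutate_cluster n \<nu> k B L Y"
  shows "triangulation_seed (D(k := {b, d})) (mutate_B k B) (commutation_exponents \<nu> Y') Y'"
proof -
  interpret flip n D k a b c d
    using seed_tri k sur by unfold_locales
  have flipped: "flipped = D(k := {b, d})" by (simp add: flipped_def)
  have quad4: "{a, b, c, d} \<subseteq> {..n + 2}"
    using sides all_chords_chord[OF tri, of "{a, b}"] all_chords_chord[OF tri, of "{c, d}"]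
    by (simp add: chord_doubleton)
  have col: "B i k = quad_column (D i) a b c d" if "i \<in> {1..n}" for i
  proof -
    obtain p q r s where "surrounds n D k p q r s" "\<forall>i \<in> {1..n}. B i k = quad_column (D i) p q r s"
      using seed_exch k unfolding exchange_matrix_of_def column_from_quad_def by blast
    then show ?thesis
      using surrounds_unique[OF tri sur] quad_column_rotate that by fastforce
  qed
  have "Y' k = seed_monomial (\<lambda>i. max (B i k) 0 - (if i = k then 1 else 0)) +
      seed_monomial (\<lambda>i. max (- B i k) 0 - (if i = k then 1 else 0))"
    by (simp add: Y' mutate_cluster_def)
  also have "seed_monomial (\<lambda>i. max (B i k) 0 - (if i = k then 1 else 0)) =
      seed_monomial (\<lambda>i. chord_indicator D {a, b} i + chord_indicator D {c, d} i - (if i = k then 1 else 0))"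
    by (intro cluster_monomial_cong) (simp only: col quad_column_parts[OF quad] chord_indicator_def)
  also have "seed_monomial (\<lambda>i. max (- B i k) 0 - (if i = k then 1 else 0)) =
      seed_monomial (\<lambda>i. chord_indicator D {b, c} i + chord_indicator D {d, a} i - (if i = k then 1 else 0))"
    by (intro cluster_monomial_cong) (simp only: col quad_column_parts[OF quad] chord_indicator_def)
  finally have "lambda_length (D k) * Y' k = exchange_term (D k) {a, b} {c, d} + exchange_term (D k) {b, c} {d, a}"
    using sides k by (simp add: distrib_left seed_exchange_term)
  also have "\<dots> = lambda_length (D k) * lambda_length {b, d}"
    using quantum_ptolemy[OF quad quad4] by (simp add: Dk)
  finally have Y'k: "Y' k = lambda_length {b, d}"
    using lambda_length_nonzero[OF seed_chord[OF k]] by simp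
  have val': "Y' i = lambda_length (flipped i)" if "i \<in> {1..n}" for i
    using that Y'k seed_Y by (cases "i = k") (simp_all add: flipped_k flipped_other Y' mutate_cluster_def)
  have "commutation_exponents \<nu> Y' i j = pairing (flipped i) (flipped j)" if ij: "i \<in> {1..n}" "j \<in> {1..n}" for i j
    unfolding commutation_exponents_def
  proof (rule the_equality)
    have chords: "chord n (flipped i)" "chord n (flipped j)" and "\<not> crossing (flipped i) (flipped j)"
      using triangulation_flip ij by (auto simp: triangulation_def all_chords_def)
    then have comm: "Y' i * Y' j = \<nu> powi (2 * pairing (flipped i) (flipped j)) * (Y' j * Y' i)"
      using lambda_length_commute ij val' by (simp add: q_commute_def)
    have square: "(\<nu>\<^sup>2) powi m = \<nu> powi (2 * m)" for m
      by (simp add: power_int_power)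
    show "Y' i * Y' j = (\<nu>\<^sup>2) powi (pairing (flipped i) (flipped j)) * (Y' j * Y' i)"
      unfolding square by (rule comm)
    fix m assume "Y' i * Y' j = (\<nu>\<^sup>2) powi m * (Y' j * Y' i)"
    then have "\<nu> powi (2 * m) * (Y' j * Y' i) = \<nu> powi (2 * pairing (flipped i) (flipped j)) * (Y' j * Y' i)"
      using comm unfolding square by (rule trans[OF sym])
    then have "\<nu> powi (2 * m) = \<nu> powi (2 * pairing (flipped i) (flipped j))"
      using lambda_length_nonzero[OF chords(1)] lambda_length_nonzero[OF chords(2)] ij val' by simp
    then show "m = pairing (flipped i) (flipped j)" by (simp add: \<nu>_powi_inject)
  qed
  then show ?thesis
    unfolding flipped[symmetric] triangulation_seed_def
    using triangulation_flip exchange_matrix_flip[OF seed_exch] val' by blast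
qed

end

definition fan :: "nat \<Rightarrow> nat set" where
  "fan i = {0, i + 1}"

lemma fan_spoke:
  assumes "1 \<le> c" "c \<le> n + 2"
  shows "{0, c} \<in> all_chords n fan"
proof -
  have "c = 1 \<or> c = n + 2 \<or> c - 1 \<in> {1..n}" using assms by auto
  then consider "c = 1" | "c = n + 2" | "c - 1 \<in> {1..n}" by blast
  then show ?thesis
  proof cases
    case 1
    then have "{0, c} = {0, 0 + 1}" by simp
    then show ?thesis unfolding all_chords_def edges_def by blast
  next
    case 3
    moreover have "{0, c} = fan (c - 1)" using assms by (simp add: fan_def)
    ultimately show ?thesis unfolding all_chords_def by blast
  qed (simp add: all_chords_def edges_def)
qed

lemma fan_triangulation: "triangulation n fan"
  unfolding triangulation_def
proof (intro conjI ballI)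
  show "inj_on fan {1..n}" by (auto simp: inj_on_def fan_def doubleton_eq_iff)
next
  fix i assume "i \<in> {1..n}"
  then show "chord n (fan i)" "fan i \<notin> edges n"
    by (auto simp: fan_def chord_doubleton edges_def doubleton_eq_iff)
next
  fix \<alpha> \<beta> assume ab: "\<alpha> \<in> all_chords n fan" "\<beta> \<in> all_chords n fan"
  then have "chord n \<alpha>" "chord n \<beta>"
    by (auto simp: all_chords_def fan_def chord_doubleton edge_chord)
  moreover have "\<not> crossing {0, c} {0, d}" for c d
    by (auto simp: crossing_def doubleton_eq_iff quad_def cyclic_def)
  moreover have "\<alpha> \<in> edges n \<or> \<beta> \<in> edges n \<or> (\<exists>c d. \<alpha> = {0, c} \<and> \<beta> = {0, d})"
    using ab unfolding all_chords_def fan_def by blast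
  ultimately show "\<not> crossing \<alpha> \<beta>"
    using edge_not_crossing crossing_sym by metis
qed

lemma fan_exchange: "exchange_matrix_of n fan (B_init n)"
  unfolding exchange_matrix_of_def column_from_quad_def
proof (intro ballI exI conjI)
  fix k assume k: "k \<in> {1..n}"
  have "{k, k + 1} \<in> edges n" "{k + 1, k + 2} \<in> edges n"
    using k edges_intro[of k] edges_intro[of "k + 1"] by simp_all
  moreover have "{0, k} \<in> all_chords n fan" "{0, k + 2} \<in> all_chords n fan"
    using k fan_spoke[of k] fan_spoke[of "k + 2"] by simp_all
  ultimately have "{{0, k}, {k, k + 1}, {k + 1, k + 2}, {k + 2, 0}} \<subseteq> all_chords n fan"
    by (simp add: insert_commute edges_all_chords)
  then show "surrounds n fan k 0 k (k + 1) (k + 2)"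
    using k by (simp add: surrounds_def fan_def quad_def cyclic_def)
  fix i assume "i \<in> {1..n}"
  then show "B_init n i k = quad_column (fan i) 0 k (k + 1) (k + 2)"
    using k by (auto simp: B_init_def quad_column_def fan_def doubleton_eq_iff)
qed

lemma triangulation_seed_fan: "triangulation_seed fan (B_init n) (Lambda_init n) (X_init \<iota>)"
  unfolding triangulation_seed_def
proof (intro conjI ballI)
  fix i assume i: "i \<in> {1..n}"
  show "X_init \<iota> i = lambda_length (fan i)"
    using i by (simp add: X_init_def fan_def lambda_length_doubleton chord_value_eq term_range_def term_exp_def
        edge_exp_def vertex_exp_def torus_monomial_def)
  fix j assume j: "j \<in> {1..n}"
  have "pairing (fan i) (fan j) = Lambda_form n (term_exp n 0 (i + 1) 0) (term_exp n 0 (j + 1) 0)"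
    unfolding fan_def using i j n_even
    by (subst Lambda_term_term) (auto simp: pairing_doubleton chord_pairing_def term_range_def)
  also have "\<dots> = Lambda_form n (Poly_Mapping.single i 1) (Poly_Mapping.single j 1)"
    using i j by (simp add: term_exp_def edge_exp_def vertex_exp_def)
  finally show "Lambda_init n i j = pairing (fan i) (fan j)"
    using i j by (simp add: Lambda_form_single)
qed (fact fan_triangulation fan_exchange)+

lemma quantum_seed_triangulation:
  "quantum_seed n \<iota> B L Y \<Longrightarrow> \<exists>D. triangulation_seed D B L Y"
proof (induction rule: quantum_seed.induct)
  case initial
  show ?case using triangulation_seed_fan by blast
next
  case (mutation B L Y k Y')
  then obtain D where D: "triangulation_seed D B L Y" by blast
  then obtain p q r s where "surrounds n D k p q r s"
    using mutation.hyps unfolding triangulation_seed_def exchange_matrix_of_def column_from_quad_def by blast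
  then show ?case using seed_flip[OF D] mutation.hyps by blast
qed

text \<open>
  Starting from the fan at \<open>0\<close>, the chord \<open>{a, a + 1}\<close> is a side. As long as \<open>{a, m}\<close> and the part of the
  fan from \<open>m\<close> on are present, the quadrilateral around \<open>{0, m}\<close> has corners \<open>0, a, m, m + 1\<close>, and its
  flip produces \<open>{a, m + 1}\<close>.
\<close>

lemma chord_reachable:
  assumes "1 \<le> a" "a < b" "b \<le> n + 2"
  shows "\<exists>D B L Y. quantum_seed n \<iota> B L Y \<and> triangulation_seed D B L Y \<and>
    {0, a} \<in> all_chords n D \<and> {a, b} \<in> all_chords n D \<and>
    (\<forall>c. b \<le> c \<and> c \<le> n + 2 \<longrightarrow> {0, c} \<in> all_chords n D)"
proof -
  have "a + 1 \<le> b" using assms by simp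
  then show ?thesis using assms(3)
  proof (induction b rule: dec_induct)
    case base
    have "{a, a + 1} \<in> all_chords n fan"
      using base by (intro edges_all_chords edges_intro) simp
    then show ?case
      using assms base fan_spoke triangulation_seed_fan quantum_seed.initial
      by (intro exI[of _ fan] exI[of _ "B_init n"] exI[of _ "Lambda_init n"] exI[of _ "X_init \<iota>"]) simp
  next
    case (step m)
    then obtain D B L Y where q: "quantum_seed n \<iota> B L Y" and s: "triangulation_seed D B L Y"
      and sub: "{0, a} \<in> all_chords n D" "{a, m} \<in> all_chords n D"
        "\<And>c. m \<le> c \<Longrightarrow> c \<le> n + 2 \<Longrightarrow> {0, c} \<in> all_chords n D"
      by (metis Suc_leD)
    have m: "1 \<le> a" "a < m" "m \<le> n + 1" using step assms by auto
    have tri: "triangulation n D" using s by (simp add: triangulation_seed_def)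
    have "{0, m} \<in> all_chords n D" "{0, m + 1} \<in> all_chords n D" using sub(3) m by auto
    moreover have "{m, m + 1} \<in> all_chords n D"
      using m by (intro edges_all_chords edges_intro) simp
    moreover have "{0, m} \<notin> edges n"
      using m by (auto simp: edges_def doubleton_eq_iff)
    ultimately obtain k where k: "k \<in> {1..n}" "D k = {0, m}" and sur: "surrounds n D k 0 a m (Suc m)"
      using sub m by (auto simp: all_chords_def surrounds_def quad_def cyclic_def insert_commute)
    interpret flip n D k 0 a m "Suc m"
      using tri k sur by unfold_locales
    let ?Y = "mutate_cluster n \<nu> k B L Y"
    have "triangulation_seed flipped (mutate_B k B) (commutation_exponents \<nu> ?Y) ?Y"
      unfolding flipped_def by (rule seed_flip[OF s k(1) sur refl])
    moreover have "quantum_seed n \<iota> (mutate_B k B) (commutation_exponents \<nu> ?Y) ?Y"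
      using quantum_seed.mutation[OF q k(1) refl] .
    moreover have "{0, a} \<in> all_chords n flipped" "\<forall>c. Suc m \<le> c \<and> c \<le> n + 2 \<longrightarrow> {0, c} \<in> all_chords n flipped"
      using sub m by (auto intro!: old_in_all_chords simp: doubleton_eq_iff)
    ultimately show ?case using new_in_all_chords by auto
  qed
qed

lemma quantum_cluster_variables_eq:
  "quantum_cluster_variables n \<iota> = lambda_length ` {\<alpha>. chord n \<alpha> \<and> \<alpha> \<notin> edges n}"
proof (intro equalityI subsetI)
  fix x assume "x \<in> quantum_cluster_variables n \<iota>"
  then obtain B L Y i where "quantum_seed n \<iota> B L Y" "i \<in> {1..n}" "x = Y i"
    by (auto simp: quantum_cluster_variables_def)
  then show "x \<in> lambda_length ` {\<alpha>. chord n \<alpha> \<and> \<alpha> \<notin> edges n}"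
    using quantum_seed_triangulation unfolding triangulation_seed_def triangulation_def by blast
next
  have mem: "lambda_length \<alpha> \<in> quantum_cluster_variables n \<iota>"
    if q: "quantum_seed n \<iota> B L Y" and s: "triangulation_seed D B L Y"
      and \<alpha>: "\<alpha> \<in> all_chords n D" "\<alpha> \<notin> edges n" for B L Y D \<alpha>
  proof -
    obtain i where i: "i \<in> {1..n}" "\<alpha> = D i"
      using \<alpha> unfolding all_chords_def by blast
    then have "lambda_length \<alpha> = Y i" using s by (simp add: triangulation_seed_def)
    then show ?thesis
      using q i unfolding quantum_cluster_variables_def by blast
  qed
  fix x assume "x \<in> lambda_length ` {\<alpha>. chord n \<alpha> \<and> \<alpha> \<notin> edges n}"
  then obtain a b where x: "x = lambda_length {a, b}" "a < b" "b \<le> n + 2" "{a, b} \<notin> edges n"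
    by (auto simp: chord_def)
  show "x \<in> quantum_cluster_variables n \<iota>"
  proof (cases "a = 0")
    case True
    then have "{a, b} \<in> all_chords n fan" using fan_spoke[of b] x by auto
    then show ?thesis using mem[OF quantum_seed.initial triangulation_seed_fan] x by blast
  next
    case False
    then show ?thesis using chord_reachable[of a b] mem x by auto
  qed
qed

end

section \<open>The frieze of lambda lengths\<close>

lemma frieze_pattern_step:
  assumes "quantum_frieze_pattern n \<nu> f" "i < n"
  shows "frieze_value n f (Suc i) j * frieze_value n f (Suc i) (j + 1) =
    1 + \<nu> * (frieze_value n f i (j + 1) * frieze_value n f (Suc (Suc i)) j)"
proof -
  have "(Suc i, j) \<in> ZQ_vertices n" using assms(2) by (simp add: ZQ_vertices_def)
  then show ?thesis
    using assms(1) unfolding quantum_frieze_pattern_def by (fastforce simp: diff_eq_eq)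
qed

text \<open>
  A slice determines the next one from the row \<open>0\<close> upwards, and the previous one from the row \<open>n + 1\<close>
  downwards, by dividing by the values of \<open>g\<close> on the known slice.
\<close>

lemma frieze_pattern_unique:
  assumes f: "quantum_frieze_pattern n \<nu> f" and g: "quantum_frieze_pattern n \<nu> g"
    and nz: "\<And>i j. i \<in> {1..n} \<Longrightarrow> g (i, j) \<noteq> 0"
    and init: "\<And>i. i \<in> {1..n} \<Longrightarrow> f (i, 0) = g (i, 0)"
  shows "i \<in> {1..n} \<Longrightarrow> f (i, j) = g (i, j)"
proof -
  let ?F = "frieze_value n f" and ?G = "frieze_value n g"
  have ends: "?F 0 j = ?G 0 j" "?F (n + 1) j = ?G (n + 1) j" for j
    by (simp_all add: frieze_value_def)
  have nz': "?G i j \<noteq> 0" if "i \<le> n + 1" for i j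
    using that nz[of i j] by (auto simp: frieze_value_def)
  have "\<forall>i \<le> n + 1. ?F i j = ?G i j"
  proof (induction j rule: int_induct[of _ 0])
    case base
    show ?case using init by (auto simp: frieze_value_def)
  next
    case (step1 j)
    have "i \<le> n \<longrightarrow> ?F i (j + 1) = ?G i (j + 1)" for i
    proof (induction i)
      case (Suc i)
      show ?case
      proof
        assume i: "Suc i \<le> n"
        then have "?G (Suc i) j * ?F (Suc i) (j + 1) = ?G (Suc i) j * ?G (Suc i) (j + 1)"
          using frieze_pattern_step[OF f, of i j] frieze_pattern_step[OF g, of i j] Suc step1 by simp
        then show "?F (Suc i) (j + 1) = ?G (Suc i) (j + 1)"
          using nz'[of "Suc i" j] i by simp
      qed
    qed (simp add: ends)
    then show ?case using ends(2)[of "j + 1"] by (metis add.commute le_Suc_eq plus_1_eq_Suc)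
  next
    case (step2 j)
    have "m \<le> n \<longrightarrow> ?F (n + 1 - m) (j - 1) = ?G (n + 1 - m) (j - 1)" for m
    proof (induction m)
      case (Suc m)
      show ?case
      proof
        assume m: "Suc m \<le> n"
        let ?i = "n - Suc m"
        have i: "n + 1 - Suc m = Suc ?i" "n + 1 - m = Suc (Suc ?i)" "?i < n" "?i \<le> n + 1" using m by auto
        then have "?F (Suc ?i) (j - 1) * ?G (Suc ?i) j = ?G (Suc ?i) (j - 1) * ?G (Suc ?i) j"
          using frieze_pattern_step[OF f i(3), of "j - 1"] frieze_pattern_step[OF g i(3), of "j - 1"] Suc m step2
          by simp
        then show "?F (n + 1 - Suc m) (j - 1) = ?G (n + 1 - Suc m) (j - 1)"
          using nz'[of "Suc ?i" j] i by simp
      qed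
    qed (use ends in simp)
    then have "?F i (j - 1) = ?G i (j - 1)" if "i \<le> n + 1" "0 < i" for i
      using that by (metis Suc_eq_plus1 diff_diff_cancel diff_le_mono2 diff_Suc_1 less_eq_Suc_le One_nat_def Suc_leI)
    then show ?case using ends(1) by (metis gr0I)
  qed
  then have "i \<le> n + 1 \<Longrightarrow> ?F i j = ?G i j" by blast
  then show "i \<in> {1..n} \<Longrightarrow> f (i, j) = g (i, j)"
    by (simp add: frieze_value_def split: if_splits)
qed

text \<open>
  Vertices are labelled by all integers modulo \<open>n + 3\<close>.
\<close>

definition polygon_vertex :: "nat \<Rightarrow> int \<Rightarrow> nat" where
  "polygon_vertex n j = nat (j mod (int n + 3))"

lemma polygon_vertex_le: "polygon_vertex n j \<le> n + 2"
proof -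
  have "j mod (int n + 3) < int n + 3" by (rule pos_mod_bound) simp
  then show ?thesis unfolding polygon_vertex_def by linarith
qed

lemma polygon_vertex_add:
  assumes "m \<le> n + 3"
  shows "polygon_vertex n (j + int m) =
    (if polygon_vertex n j + m < n + 3 then polygon_vertex n j + m else polygon_vertex n j + m - (n + 3))"
proof -
  let ?N = "int n + 3"
  have r: "0 \<le> j mod ?N" "j mod ?N < ?N" by simp_all
  have m: "int m \<le> ?N" using assms by simp
  have "(j + int m) mod ?N = (j mod ?N + int m) mod ?N" by (simp add: mod_add_left_eq)
  also have "\<dots> = (if j mod ?N + int m < ?N then j mod ?N + int m else j mod ?N + int m - ?N)"
  proof (cases "j mod ?N + int m < ?N")
    case False
    then have "(j mod ?N + int m) mod ?N = (j mod ?N + int m - ?N) mod ?N" by simp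
    also have "\<dots> = j mod ?N + int m - ?N"
      using False r m by (intro mod_pos_pos_trivial) linarith+
    finally show ?thesis using False by simp
  qed (use r in \<open>simp add: mod_pos_pos_trivial\<close>)
  finally show ?thesis
    unfolding polygon_vertex_def using r m by (cases "j mod ?N + int m < ?N"; simp; linarith)
qed

lemma polygon_vertex_period: "polygon_vertex n (j + int (n + 3)) = polygon_vertex n j"
  using polygon_vertex_le[of n j] by (subst polygon_vertex_add) auto

lemma polygon_vertex_small: "0 \<le> j \<Longrightarrow> j \<le> int n + 2 \<Longrightarrow> polygon_vertex n j = nat j"
  by (simp add: polygon_vertex_def)

lemma side_edge: 
  "{polygon_vertex n j, polygon_vertex n (j + 1)} \<in> edges n"
  "{polygon_vertex n j, polygon_vertex n (j + int (n + 2))} \<in> edges n"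
proof -
  have 1: "{polygon_vertex n j, polygon_vertex n (j + 1)} \<in> edges n" for j
  proof (cases "polygon_vertex n j = n + 2")
    case True
    then have "polygon_vertex n (j + 1) = 0"
      using polygon_vertex_add[of 1 n j] by simp
    with True show ?thesis unfolding edges_def by (simp add: insert_commute)
  next
    case False
    then have "polygon_vertex n (j + 1) = polygon_vertex n j + 1"
      using polygon_vertex_add[of 1 n j] polygon_vertex_le[of n j] by simp
    with False show ?thesis
      using polygon_vertex_le[of n j] edges_intro[of "polygon_vertex n j" n] by simp
  qed
  then show "{polygon_vertex n j, polygon_vertex n (j + 1)} \<in> edges n" .
  have "j + int (n + 2) + 1 = j + int (n + 3)" by simp
  then show "{polygon_vertex n j, polygon_vertex n (j + int (n + 2))} \<in> edges n"
    using 1[of "j + int (n + 2)"] polygon_vertex_period[of n j] by (simp only: insert_commute)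
qed

lemma polygon_quad:
  assumes "1 \<le> i" "i \<le> n"
  shows "quad (polygon_vertex n j) (polygon_vertex n (j + 1))
    (polygon_vertex n (j + int i + 1)) (polygon_vertex n (j + int i + 2))"
proof -
  let ?v = "polygon_vertex n j"
  have "polygon_vertex n (j + 1) = (if ?v + 1 < n + 3 then ?v + 1 else ?v + 1 - (n + 3))"
    "polygon_vertex n (j + int i + 1) = (if ?v + i + 1 < n + 3 then ?v + i + 1 else ?v + i + 1 - (n + 3))"
    "polygon_vertex n (j + int i + 2) = (if ?v + i + 2 < n + 3 then ?v + i + 2 else ?v + i + 2 - (n + 3))"
    using assms polygon_vertex_add[of 1 n j] polygon_vertex_add[of "i + 1" n j]
      polygon_vertex_add[of "i + 2" n j] by (simp_all add: ac_simps)
  moreover have "?v \<le> n + 2" by (rule polygon_vertex_le)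
  ultimately show ?thesis
    using assms unfolding quad_def cyclic_def by (cases "?v + i + 2 < n + 3"; cases "?v + i + 1 < n + 3"; cases "?v + 1 < n + 3"; simp; linarith?)
qed

text \<open>
  For a quadrilateral with the sides \<open>pq\<close> and \<open>rs\<close> on the boundary, the power of \<open>\<nu>\<close> in the second
  term of the Ptolemy relation is the \<open>\<nu> = q\<^sup>1\<^sup>/\<^sup>2\<close> of the frieze rule. The four cases are the places where
  the step from \<open>n + 2\<close> to \<open>0\<close> can occur: between \<open>s\<close> and \<open>p\<close>, on the side \<open>rs\<close>, between \<open>q\<close> and \<open>r\<close>, and on
  the side \<open>pq\<close>.
\<close>

lemma consecutive_exchange_exponent:
  assumes "even n" and q: "quad p q r s" and le: "p \<le> n + 2" "r \<le> n + 2"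
    and succ: "q = (if p = n + 2 then 0 else p + 1)" "s = (if r = n + 2 then 0 else r + 1)"
  shows "pairing {p, r} {q, r} + pairing {p, r} {s, p} - pairing {q, r} {s, p} = 1"
proof -
  consider "q = p + 1" "s = r + 1" "p + 1 < r" | "q = p + 1" "s = 0" "r = n + 2" "0 < p" "p + 1 < r"
    | "q = p + 1" "s = r + 1" "r + 1 < p" | "q = 0" "p = n + 2" "s = r + 1" "0 < r" "r + 1 < p"
    using q le succ unfolding quad_def cyclic_def by (auto split: if_splits)
  then show ?thesis
  proof cases
    case 1
    then show ?thesis
      by (simp add: pairing_doubleton insert_commute[of "Suc r"] pairing_values)
  next
    case 2
    then show ?thesis using assms(1)
      by (simp add: pairing_doubleton pairing_values)
  next
    case 3
    then show ?thesis
      by (simp add: pairing_doubleton insert_commute[of p r] insert_commute[of "Suc p"] pairing_values)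
  next
    case 4
    then show ?thesis using assms(1)
      by (simp add: pairing_doubleton insert_commute[of "Suc (Suc n)" r] pairing_values)
  qed
qed

context torus_fractions
begin

definition polygon_frieze :: "nat \<times> int \<Rightarrow> 'a" where
  "polygon_frieze = (\<lambda>(i, j). lambda_length {polygon_vertex n j, polygon_vertex n (j + int i + 1)})"

lemma frieze_value_polygon_frieze:
  assumes "i \<le> n + 1"
  shows "frieze_value n polygon_frieze i j = lambda_length {polygon_vertex n j, polygon_vertex n (j + int i + 1)}"
proof -
  have "i = 0 \<or> i = n + 1 \<or> i \<noteq> 0 \<and> i \<noteq> n + 1" by blast
  then show ?thesis
    using lambda_length_edge[OF side_edge(1)[of n j]] lambda_length_edge[OF side_edge(2)[of n j]]
    by (auto simp: frieze_value_def polygon_frieze_def algebra_simps)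
qed

lemma polygon_frieze_pattern: "quantum_frieze_pattern n \<nu> polygon_frieze"
  unfolding quantum_frieze_pattern_def
proof (clarify)
  fix i j assume "(i, j) \<in> ZQ_vertices n"
  then have i: "1 \<le> i" "i \<le> n" by (auto simp: ZQ_vertices_def)
  let ?v = "polygon_vertex n"
  define p q r s where pqrs: "p = ?v j" "q = ?v (j + 1)" "r = ?v (j + int i + 1)" "s = ?v (j + int i + 2)"
  have quad: "quad p q r s" using polygon_quad[OF i, of j] by (simp add: pqrs)
  have le: "p \<le> n + 2" "q \<le> n + 2" "r \<le> n + 2" "s \<le> n + 2"
    by (simp_all add: pqrs polygon_vertex_le del: add_2_eq_Suc')
  have e: "{p, q} \<in> edges n" "{r, s} \<in> edges n"
    using side_edge(1)[of n j] side_edge(1)[of n "j + int i + 1"] by (simp_all add: pqrs add.assoc)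
  have ch: "chord n {p, r}" "chord n {q, r}" "chord n {s, p}"
    using quad_distinct[OF quad] le by (simp_all add: chord_doubleton)
  have "exchange_term {p, r} {p, q} {r, s} = 1"
    using e pairing_edge ch edge_chord by (simp add: exchange_term_def lambda_length_edge)
  moreover have "exchange_term {p, r} {q, r} {s, p} = \<nu> * (lambda_length {q, r} * lambda_length {s, p})"
  proof -
    have "pairing {p, r} {q, r} + pairing {p, r} {s, p} - pairing {q, r} {s, p} = 1"
    proof (rule consecutive_exchange_exponent[OF n_even quad le(1,3)])
      show "q = (if p = n + 2 then 0 else p + 1)"
        using polygon_vertex_add[of 1 n j] le by (auto simp: pqrs)
      show "s = (if r = n + 2 then 0 else r + 1)"
        using polygon_vertex_add[of 1 n "j + int i + 1"] le by (auto simp: pqrs add.assoc)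
    qed
    then show ?thesis by (simp add: exchange_term_def)
  qed
  ultimately have "lambda_length {p, r} * lambda_length {q, s} = 1 + \<nu> * (lambda_length {q, r} * lambda_length {s, p})"
    using quantum_ptolemy[OF quad] le by simp
  moreover have "frieze_value n polygon_frieze i j = lambda_length {p, r}" "frieze_value n polygon_frieze i (j + 1) = lambda_length {q, s}"
    "frieze_value n polygon_frieze (i - 1) (j + 1) = lambda_length {q, r}" "frieze_value n polygon_frieze (i + 1) j = lambda_length {s, p}"
    using i by (simp_all add: frieze_value_polygon_frieze pqrs algebra_simps insert_commute of_nat_diff)
  ultimately show "frieze_value n polygon_frieze i j * frieze_value n polygon_frieze i (j + 1) -
      \<nu> * (frieze_value n polygon_frieze (i - 1) (j + 1) * frieze_value n polygon_frieze (i + 1) j) = 1"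
    by simp
qed

lemma polygon_frieze_nonzero:
  assumes "i \<in> {1..n}"
  shows "polygon_frieze (i, j) \<noteq> 0"
proof -
  have "quad (polygon_vertex n j) (polygon_vertex n (j + 1))
    (polygon_vertex n (j + int i + 1)) (polygon_vertex n (j + int i + 2))"
    using assms by (intro polygon_quad) auto
  then have "chord n {polygon_vertex n j, polygon_vertex n (j + int i + 1)}"
    using polygon_vertex_le by (auto simp: chord_doubleton dest!: quad_distinct)
  then show ?thesis by (simp add: polygon_frieze_def lambda_length_nonzero)
qed

lemma polygon_frieze_initial:
  assumes "i \<in> {1..n}"
  shows "polygon_frieze (i, 0) = X_init \<iota> i"
  using assms triangulation_seed_fan
  by (simp add: polygon_frieze_def polygon_vertex_small triangulation_seed_def fan_def nat_add_distrib)

text \<open>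
  The automorphism \<open>phi\<close> maps the chord from \<open>j\<close> to \<open>j + i + 1\<close> to the one from \<open>j + i + 1\<close> to
  \<open>j + n + 3\<close>, which is the same vertex as \<open>j\<close>.
\<close>

lemma polygon_frieze_periodic:
  assumes "i \<in> {1..n}"
  shows "polygon_frieze (phi n (i, j)) = polygon_frieze (i, j)"
proof -
  have "j + int i + 1 + int (n - i + 1) + 1 = j + int (n + 3)" using assms by simp
  then show ?thesis
    using polygon_vertex_period[of n j] by (simp only: polygon_frieze_def phi_def prod.case insert_commute)
qed

lemma lambda_length_inj: "inj_on lambda_length {\<alpha>. chord n \<alpha> \<and> \<alpha> \<notin> edges n}"
proof (rule inj_onI, clarify)
  fix \<alpha> \<beta>
  assume a: "chord n \<alpha>" "\<alpha> \<notin> edges n" and b: "chord n \<beta>" "\<beta> \<notin> edges n" and eq: "lambda_length \<alpha> = lambda_length \<beta>"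
  obtain a b c d where ab: "\<alpha> = {a, b}" "a < b" "b \<le> n + 2" and cd: "\<beta> = {c, d}" "c < d" "d \<le> n + 2"
    using a(1) b(1) unfolding chord_def by blast
  have d1: "a + 1 \<noteq> b" "(a, b) \<noteq> (0, n + 2)" using a(2) ab by (auto simp: edges_def)
  have d2: "c + 1 \<noteq> d" "(c, d) \<noteq> (0, n + 2)" using b(2) cd by (auto simp: edges_def)
  have "chord_torus n a b = chord_torus n c d"
    using eq inj_onD[OF \<iota>_inj] ab cd by (simp add: lambda_length_doubleton chord_value_def)
  then show "\<alpha> = \<beta>"
    using chord_torus_inject[of n a b c d] ab cd d1 d2 by auto
qed

lemma Gamma_vertices_diagonals:
  "bij_betw (\<lambda>(i, j). {nat j, nat j + i + 1}) (Gamma_vertices n) {\<alpha>. chord n \<alpha> \<and> \<alpha> \<notin> edges n}"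
  unfolding bij_betw_def
proof (intro conjI equalityI subsetI)
  show "inj_on (\<lambda>(i, j). {nat j, nat j + i + 1}) (Gamma_vertices n)"
    by (auto simp: inj_on_def Gamma_vertices_def ZQ_vertices_def doubleton_eq_iff)
next
  fix \<alpha> assume "\<alpha> \<in> (\<lambda>(i, j). {nat j, nat j + i + 1}) ` Gamma_vertices n"
  then obtain i j where ij: "1 \<le> i" "i \<le> n" "0 \<le> j" "int i + j \<le> int n + 1" "\<alpha> = {nat j, nat j + i + 1}"
    by (auto simp: Gamma_vertices_def ZQ_vertices_def)
  then show "\<alpha> \<in> {\<alpha>. chord n \<alpha> \<and> \<alpha> \<notin> edges n}"
    by (auto simp: chord_doubleton edges_def doubleton_eq_iff)
next
  fix \<alpha> assume "\<alpha> \<in> {\<alpha>. chord n \<alpha> \<and> \<alpha> \<notin> edges n}"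
  then obtain a b where ab: "\<alpha> = {a, b}" "a < b" "b \<le> n + 2" "\<alpha> \<notin> edges n"
    by (auto simp: chord_def)
  then have "b \<noteq> a + 1" "(a, b) \<noteq> (0, n + 2)" by (auto simp: edges_def)
  then have "(b - a - 1, int a) \<in> Gamma_vertices n" "\<alpha> = (\<lambda>(i, j). {nat j, nat j + i + 1}) (b - a - 1, int a)"
    using ab by (auto simp: Gamma_vertices_def ZQ_vertices_def)
  then show "\<alpha> \<in> (\<lambda>(i, j). {nat j, nat j + i + 1}) ` Gamma_vertices n" by blast
qed

end

theorem theorem3p2:
  fixes n :: nat
    and \<iota> :: "torus \<Rightarrow> 'a::division_ring"
    and f :: "nat \<times> int \<Rightarrow> 'a"
  assumes "n > 0" and "even n"
    and "skew_field_of_fractions n \<iota>"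
    and "quantum_frieze_of_variables n \<iota> f"
  shows "induces_frieze_pattern_on_Gamma n f \<and>
         bij_betw f (Gamma_vertices n) (quantum_cluster_variables n \<iota>)"
proof -
  interpret torus_fractions n \<iota>
    by standard fact+
  have f: "f (i, j) = polygon_frieze (i, j)" if "i \<in> {1..n}" for i j
  proof (rule frieze_pattern_unique[OF _ polygon_frieze_pattern polygon_frieze_nonzero _ that])
    show "quantum_frieze_pattern n \<nu> f"
      using assms(4) by (simp add: quantum_frieze_of_variables_def)
    show "f (k, 0) = polygon_frieze (k, 0)" if "k \<in> {1..n}" for k
      using assms(4) that polygon_frieze_initial[of k] by (simp add: quantum_frieze_of_variables_def)
  qed
  have "f (phi n p) = f p" if "p \<in> ZQ_vertices n" for p
  proof -
    from that obtain i j where p: "p = (i, j)" "i \<in> {1..n}" by (auto simp: ZQ_vertices_def)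
    moreover have "n - i + 1 \<in> {1..n}" using p by auto
    ultimately show ?thesis
      using f polygon_frieze_periodic[of i j] by (simp add: phi_def)
  qed
  then have "induces_frieze_pattern_on_Gamma n f"
    by (simp add: induces_frieze_pattern_on_Gamma_def)
  moreover have "bij_betw f (Gamma_vertices n) (quantum_cluster_variables n \<iota>)"
  proof -
    have "f p = (lambda_length \<circ> (\<lambda>(i, j). {nat j, nat j + i + 1})) p" if p: "p \<in> Gamma_vertices n" for p
    proof -
      obtain i j where ij: "p = (i, j)" "i \<in> {1..n}" "0 \<le> j" "int i + j \<le> int n + 1"
        using p by (auto simp: Gamma_vertices_def ZQ_vertices_def)
      then have "nat (j + int i + 1) = nat j + i + 1" by (simp add: nat_add_distrib)
      then show ?thesis
        using ij by (simp add: f polygon_frieze_def polygon_vertex_small)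
    qed
    moreover have "bij_betw (lambda_length \<circ> (\<lambda>(i, j). {nat j, nat j + i + 1})) (Gamma_vertices n)
        (quantum_cluster_variables n \<iota>)"
      unfolding quantum_cluster_variables_eq
      by (rule bij_betw_trans[OF Gamma_vertices_diagonals inj_on_imp_bij_betw[OF lambda_length_inj]])
    ultimately show ?thesis by (simp cong: bij_betw_cong)
  qed
  ultimately show ?thesis ..
qed

end
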